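(* Let $\alpha>0$. For any function $u\in W^{1,2}\big((0,\infty),e^{-\frac{s^2}{2}}s^{\alpha-1}ds\big)$, the following sharp inequality holds: $$\int_0^\infty|u'(s)|^2e^{-\frac{s^2}{2}}s^{\alpha-1}\,ds\ge 2\inf_{c\in\mathbb{R}}\int_0^\infty|u(s)-c|^2e^{-\frac{s^2}{2}}s^{\alpha-1}\,ds.$$ The constant $2$ is optimal and attained precisely by functions of the form $u(s)=a_0+a_1s^2$, where $a_0,a_1\in\mathbb{R}$.
   Context: $W^{1,2}((0,\infty),\rho\,ds)$ denotes the weighted Sobolev space of real-valued functions $u$ on $(0,\infty)$ with weak derivative $u'$ such that $\int_0^\infty(|u|^2+|u'|^2)\rho\,ds<\infty$. *)

theory Defs
  imports "HOL-Analysis.Analysis"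
begin

definition test_function_on :: "real set \<Rightarrow> (real \<Rightarrow> real) \<Rightarrow> bool" where
  "test_function_on \<Omega> \<phi> \<longleftrightarrow>
     (\<forall>n x. (deriv ^^ n) \<phi> differentiable (at x)) \<and>
     compact (closure {x. \<phi> x \<noteq> 0}) \<and> closure {x. \<phi> x \<noteq> 0} \<subseteq> \<Omega>"

(* Intended for open \<Omega>. In particular u is Lebesgue measurable on \<Omega>. *)
definition locally_integrable_on :: "real set \<Rightarrow> (real \<Rightarrow> real) \<Rightarrow> bool" where
  "locally_integrable_on \<Omega> u \<longleftrightarrow> (\<forall>K. compact K \<and> K \<subseteq> \<Omega> \<longrightarrow> set_integrable lebesgue K u)"

(* g is only determined up to null sets by u, hence a relation rather than an operator. Values of
   u and g outside \<Omega> are irrelevant. *)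
definition has_weak_derivative_on :: "real set \<Rightarrow> (real \<Rightarrow> real) \<Rightarrow> (real \<Rightarrow> real) \<Rightarrow> bool" where
  "has_weak_derivative_on \<Omega> u g \<longleftrightarrow>
     locally_integrable_on \<Omega> u \<and> locally_integrable_on \<Omega> g \<and>
     (\<forall>\<phi>. test_function_on \<Omega> \<phi> \<longrightarrow>
        (LINT s:\<Omega>|lebesgue. u s * deriv \<phi> s) = - (LINT s:\<Omega>|lebesgue. g s * \<phi> s))"

definition weighted_W12 :: "real set \<Rightarrow> (real \<Rightarrow> real) \<Rightarrow> (real \<Rightarrow> real) set" where
  "weighted_W12 \<Omega> \<rho> =
     {u. \<exists>g. has_weak_derivative_on \<Omega> u g \<and>
             set_integrable lebesgue \<Omega> (\<lambda>s. (\<bar>u s\<bar>\<^sup>2 + \<bar>g s\<bar>\<^sup>2) * \<rho> s)}"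

definition gauss_weight :: "real \<Rightarrow> real \<Rightarrow> real" where
  "gauss_weight \<alpha> s = exp (- (s\<^sup>2) / 2) * s powr (\<alpha> - 1)"

end

theory Submission
  imports Defs "HOL-Real_Asymp.Real_Asymp"
begin

text \<open>
  Put \<open>r = sqrt \<alpha>\<close> and let \<open>\<rho>\<close> be the weight. For \<open>u\<close> absolutely continuous with derivative \<open>g\<close>,
  the Cauchy--Schwarz inequality with the weight \<open>2 t\<close>, the derivative of the expected extremal
  \<open>t\<^sup>2\<close>, gives
  \<open>(u x - u r)\<^sup>2 \<le> (x\<^sup>2 - \<alpha>) * \<integral> g\<^sup>2 / (2 t)\<close>, the integral being taken from \<open>r\<close> to \<open>x\<close>.
  Integrate this against \<open>\<rho>\<close> and exchange the integrals. Since \<open>(t \<rho>)' = (\<alpha> - t\<^sup>2) \<rho>\<close>, the integral of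
  \<open>\<bar>x\<^sup>2 - \<alpha>\<bar> \<rho>\<close> over all \<open>x\<close> beyond \<open>t\<close> (as seen from \<open>r\<close>) is exactly \<open>t \<rho> t\<close>, so the right-hand side
  becomes half the energy of \<open>u\<close>; thus \<open>c = u r\<close> already realises the inequality. If equality holds,
  then Cauchy--Schwarz is an equality for every \<open>x\<close>, so \<open>u\<close> is affine in \<open>x\<^sup>2\<close> on either side
  of \<open>r\<close>, and minimality of \<open>c = u r\<close> makes \<open>u r\<close> the mean of \<open>u\<close>, which forces the two slopes to agree.
\<close>

subsection \<open>Smooth bump functions\<close>

text \<open>The constant 2 is an eigenvalue: for \<open>v s = s^2 - \<alpha>\<close> one has
  \<open>- (\<rho> v')' = 2 \<rho> v\<close>, and \<open>v\<close> is orthogonal to the constants.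
  The base point \<open>r\<close> is the zero of \<open>v\<close>; for an affine function of
  \<open>s^2\<close> the value at \<open>r\<close> is therefore the mean, and the Cauchy--Schwarz
  step started at \<open>r\<close> loses nothing. Every integrand in the exchange of integrals is
  nonnegative, so Tonelli's theorem applies without prior integrability, and square integrability of
  \<open>u - u r\<close> comes out as a by-product. The obstacle is that \<open>u\<close> is only a
  Lebesgue measurable function with a weak derivative, for which \<open>u r\<close> has no meaning.
  It has to be replaced by an almost everywhere equal primitive of a Borel representative of its
  weak derivative. That is the du Bois-Reymond lemma, and its proof needs enough test functions,
  hence the bump functions.\<close>

definition smooth :: "(real \<Rightarrow> real) \<Rightarrow> bool" where
  "smooth f \<longleftrightarrow> (\<forall>n x. (deriv ^^ n) f differentiable (at x))"

text \<open>Derivatives are unique, so the witness \<open>f'\<close> is \<open>deriv f\<close>, and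
  \<open>P\<close> is preserved by \<open>deriv\<close>. Smoothness thus reduces to naming a class
  closed under differentiation, with no formula for the higher derivatives.\<close>

lemma smooth_coinduct:
  assumes "P f" and step: "\<And>f. P f \<Longrightarrow> \<exists>f'. P f' \<and> (\<forall>x. (f has_real_derivative f' x) (at x))"
  shows "smooth f"
proof -
  have P_deriv: "P (deriv f)" if f: "P f" for f
  proof -
    obtain f' where f': "P f'" "\<And>x. (f has_real_derivative f' x) (at x)"
      using step[OF f] by blast
    have "deriv f = f'" using f'(2) DERIV_imp_deriv by blast
    with f'(1) show ?thesis by simp
  qed
  have "P ((deriv ^^ n) f)" for n
    by (induction n) (auto intro: assms(1) P_deriv)
  then show ?thesis
    unfolding smooth_def using step real_differentiable_def by blast
qed

lemma smooth_deriv: "smooth f \<Longrightarrow> smooth (deriv f)"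
  unfolding smooth_def by (metis comp_apply funpow_Suc_right)

lemma smooth_has_deriv: "smooth f \<Longrightarrow> (f has_real_derivative deriv f x) (at x)"
  unfolding smooth_def by (metis funpow_0 DERIV_deriv_iff_real_differentiable)

lemma smooth_continuous_on: "smooth f \<Longrightarrow> continuous_on A f"
  using smooth_has_deriv DERIV_isCont continuous_at_imp_continuous_on by blast

lemma smooth_const: "smooth (\<lambda>x. c)"
proof (rule smooth_coinduct[where P = "\<lambda>f. \<exists>c. (\<lambda>x. c) = f"])
  show "\<exists>c'. (\<lambda>x. c') = (\<lambda>x. c)" by blast
next
  fix f :: "real \<Rightarrow> real" assume "\<exists>c. (\<lambda>x. c) = f"
  then show "\<exists>f'. (\<exists>c. (\<lambda>x. c) = f') \<and> (\<forall>x. (f has_real_derivative f' x) (at x))"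
    by (intro exI[of _ "\<lambda>x. 0"]) auto
qed

lemma smooth_add:
  assumes "smooth f" "smooth g" shows "smooth (\<lambda>x. f x + g x)"
proof (rule smooth_coinduct)
  let ?P = "\<lambda>h. \<exists>f g. smooth f \<and> smooth g \<and> h = (\<lambda>x. f x + g x)"
  show "?P (\<lambda>x. f x + g x)" using assms by blast
  fix h assume "?P h"
  then obtain f g where fg: "smooth f" "smooth g" "h = (\<lambda>x. f x + g x)" by blast
  have "(h has_real_derivative deriv f x + deriv g x) (at x)" for x
    unfolding fg(3) using fg(1,2) by (intro DERIV_add smooth_has_deriv)
  then show "\<exists>h'. ?P h' \<and> (\<forall>x. (h has_real_derivative h' x) (at x))"
    using fg(1,2) smooth_deriv by (intro exI[of _ "\<lambda>x. deriv f x + deriv g x"]) blast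
qed

text \<open>By the product rule the derivative of one product is a sum of two, so products alone are
  no invariant for \<open>smooth_coinduct\<close>; their finite sums are.\<close>

inductive sum_of_smooth_products :: "(real \<Rightarrow> real) \<Rightarrow> bool" where
  product: "smooth f \<Longrightarrow> smooth g \<Longrightarrow> sum_of_smooth_products (\<lambda>x. f x * g x)"
| sum: "sum_of_smooth_products f \<Longrightarrow> sum_of_smooth_products g \<Longrightarrow>
    sum_of_smooth_products (\<lambda>x. f x + g x)"

lemma smooth_mult:
  assumes "smooth f" "smooth g" shows "smooth (\<lambda>x. f x * g x)"
proof (rule smooth_coinduct)
  show "sum_of_smooth_products (\<lambda>x. f x * g x)" using assms by (rule product)
  fix h assume "sum_of_smooth_products h"
  then show "\<exists>h'. sum_of_smooth_products h' \<and> (\<forall>x. (h has_real_derivative h' x) (at x))"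
  proof induction
    case (product f g)
    then show ?case
      by (intro exI[of _ "\<lambda>x. deriv f x * g x + deriv g x * f x"])
        (auto intro!: sum_of_smooth_products.intros smooth_deriv DERIV_mult' smooth_has_deriv
          derivative_eq_intros)
  next
    case (sum f g)
    then show ?case by (blast intro: sum_of_smooth_products.sum DERIV_add)
  qed
qed

lemma smooth_affine:
  assumes "smooth f" shows "smooth (\<lambda>x. f (k * x + m))"
proof (rule smooth_coinduct)
  \<comment> \<open>The factor \<open>c\<close> collects the powers of \<open>k\<close> produced by
    the chain rule.\<close>
  let ?P = "\<lambda>h. \<exists>f c. smooth f \<and> h = (\<lambda>x. c * f (k * x + m))"
  show "?P (\<lambda>x. f (k * x + m))" using assms by (intro exI[of _ f] exI[of _ 1]) auto
  fix h assume "?P h"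
  then obtain f c where f: "smooth f" "h = (\<lambda>x. c * f (k * x + m))" by blast
  have "(h has_real_derivative (c * k) * deriv f (k * x + m)) (at x)" for x
    unfolding f(2)
    by (rule derivative_eq_intros DERIV_chain2[OF smooth_has_deriv[OF f(1)]] refl)+ simp
  then show "\<exists>h'. ?P h' \<and> (\<forall>x. (h has_real_derivative h' x) (at x))"
    using f(1) smooth_deriv by (intro exI[of _ "\<lambda>x. (c * k) * deriv f (k * x + m)"]) blast
qed

lemma smooth_antiderivative:
  assumes "smooth f" and "\<And>x. (F has_real_derivative f x) (at x)"
  shows "smooth F"
proof (rule smooth_coinduct[where P = "\<lambda>h. h = F \<or> smooth h"])
  fix h assume "h = F \<or> smooth h"
  then show "\<exists>h'. (h' = F \<or> smooth h') \<and> (\<forall>x. (h has_real_derivative h' x) (at x))"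
    using assms smooth_deriv smooth_has_deriv by blast
qed simp

text \<open>The classical flat function \<open>exp (- (1 / x))\<close>, extended by zero. A
  polynomial in \<open>1 / x\<close> is carried along because differentiation changes nothing else,
  which makes the family closed under \<open>deriv\<close>.\<close>

definition flat_exp :: "real poly \<Rightarrow> real \<Rightarrow> real" where
  "flat_exp p x = (if 0 < x then poly p (1 / x) * exp (- (1 / x)) else 0)"

lemma poly_times_exp_neg_tendsto_0: "((\<lambda>y::real. poly p y * exp (- y)) \<longlongrightarrow> 0) at_top"
proof -
  have "((\<lambda>y. \<Sum>i\<le>degree p. coeff p i * (y ^ i / exp y)) \<longlongrightarrow>
      (\<Sum>i\<le>degree p. coeff p i * 0)) at_top"
    by (intro tendsto_sum tendsto_mult tendsto_const tendsto_power_div_exp_0)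
  moreover have "(\<Sum>i\<le>degree p. coeff p i * (y ^ i / exp y)) = poly p y * exp (- y)" for y :: real
    by (simp add: poly_altdef sum_distrib_right exp_minus divide_inverse mult.assoc)
  ultimately show ?thesis by simp
qed

lemma flat_exp_has_derivative:
  "(flat_exp p has_real_derivative flat_exp ([:0, 0, 1:] * (p - pderiv p)) x) (at x)"
proof -
  let ?q = "[:0, 0, 1:] * (p - pderiv p)"
  consider "0 < x" | "x < 0" | "x = 0" by linarith
  then show ?thesis
  proof cases
    case 1
    have "((\<lambda>x. poly p (1 / x) * exp (- (1 / x))) has_real_derivative
        poly ?q (1 / x) * exp (- (1 / x))) (at x)"
      using 1
      by (auto intro!: derivative_eq_intros DERIV_chain2[OF poly_DERIV]
          simp: field_simps power2_eq_square)
    then have "(flat_exp p has_real_derivative poly ?q (1 / x) * exp (- (1 / x))) (at x)"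
      by (rule DERIV_cong_ev[THEN iffD2, OF refl _ refl, rotated])
        (use 1 in \<open>auto simp: flat_exp_def intro!: eventually_mono[OF eventually_nhds_in_open[of "{0<..}"]]\<close>)
    then show ?thesis using 1 by (simp add: flat_exp_def)
  next
    case 2
    have "(flat_exp p has_real_derivative 0) (at x)"
      by (rule DERIV_cong_ev[where g = "\<lambda>x. 0", THEN iffD2, OF refl _ refl])
        (use 2 in \<open>auto simp: flat_exp_def
          intro!: eventually_mono[OF eventually_nhds_in_open[of "{..<0}"]]\<close>)
    then show ?thesis using 2 by (simp add: flat_exp_def)
  next
    case 3
    \<comment> \<open>The right-hand difference quotient at 0, rewritten in \<open>1 / h\<close>:
      dividing by \<open>h\<close> multiplies the polynomial by the monomial
      \<open>[:0, 1:]\<close>, and exponential decay still wins.\<close>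
    have "((\<lambda>h. poly ([:0, 1:] * p) (inverse h) * exp (- inverse h)) \<longlongrightarrow> 0) (at_right (0::real))"
      using filterlim_compose[OF poly_times_exp_neg_tendsto_0 filterlim_inverse_at_top_right] .
    then have "((\<lambda>h. flat_exp p h / h) \<longlongrightarrow> 0) (at_right 0)"
      by (rule Lim_transform_eventually)
        (auto simp: flat_exp_def eventually_at_filter field_simps)
    moreover have "((\<lambda>h. flat_exp p h / h) \<longlongrightarrow> 0) (at_left 0)"
      by (rule Lim_transform_eventually[OF tendsto_const])
        (auto simp: flat_exp_def eventually_at_filter)
    ultimately have "((\<lambda>h. flat_exp p h / h) \<longlongrightarrow> 0) (at 0)"
      by (simp add: filterlim_split_at)
    then show ?thesis using 3 by (simp add: DERIV_def flat_exp_def)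
  qed
qed

lemma smooth_flat_exp: "smooth (flat_exp p)"
proof (rule smooth_coinduct[where P = "\<lambda>f. f \<in> range flat_exp"])
  show "\<exists>f'. f' \<in> range flat_exp \<and> (\<forall>x. (f has_real_derivative f' x) (at x))"
    if "f \<in> range flat_exp" for f
    using that flat_exp_has_derivative by blast
qed simp

text \<open>The parameter \<open>n\<close> steepens both flanks while the support stays fixed. The
  bumps stay below 1 and converge pointwise to the indicator of the open interval, as dominated
  convergence requires.\<close>

definition bump :: "real \<Rightarrow> real \<Rightarrow> nat \<Rightarrow> real \<Rightarrow> real" where
  "bump a b n x = flat_exp 1 (n * (x - a)) * flat_exp 1 (n * (b - x))"

lemma smooth_bump: "smooth (bump a b n)"
proof -
  have "smooth (\<lambda>x. flat_exp 1 (n * x + (- n * a)) * flat_exp 1 (- n * x + n * b))"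
    by (intro smooth_mult smooth_affine smooth_flat_exp)
  then show ?thesis by (simp add: bump_def[abs_def] algebra_simps)
qed

lemma bump_eq_0: "x \<notin> {a<..<b} \<Longrightarrow> bump a b n x = 0"
  by (auto simp: bump_def flat_exp_def zero_less_mult_iff)

lemma bump_nonneg: "0 \<le> bump a b n x"
  by (auto simp: bump_def flat_exp_def)

lemma bump_pos: "0 < n \<Longrightarrow> x \<in> {a<..<b} \<Longrightarrow> 0 < bump a b n x"
  by (auto simp: bump_def flat_exp_def)

lemma bump_le_1: "bump a b n x \<le> 1"
  by (auto simp: bump_def flat_exp_def intro!: mult_le_one)

lemma bump_tendsto_indicator: "(\<lambda>n. bump a b n x) \<longlonglongrightarrow> indicator {a<..<b} x"
proof (cases "x \<in> {a<..<b}")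
  case True
  have *: "(\<lambda>n. flat_exp 1 (real n * c)) \<longlonglongrightarrow> 1" if "0 < c" for c
  proof -
    have "(\<lambda>n. exp (- ((1 / c) * (1 / real n)))) \<longlonglongrightarrow> exp (- ((1 / c) * 0))"
      by (intro tendsto_intros lim_1_over_n)
    then have "(\<lambda>n. exp (- (1 / (real n * c)))) \<longlonglongrightarrow> 1" by (simp add: mult.commute)
    then show ?thesis
      by (rule Lim_transform_eventually)
        (use that in \<open>auto simp: flat_exp_def intro: eventually_mono[OF eventually_gt_at_top[of 0]]\<close>)
  qed
  have "(\<lambda>n. bump a b n x) \<longlonglongrightarrow> 1 * 1"
    unfolding bump_def using True by (intro tendsto_mult *) auto
  then show ?thesis using True by simp
qed (simp add: bump_eq_0)

subsection \<open>The du Bois-Reymond lemma on the half-line\<close>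

text \<open>Since \<open>ennreal\<close> truncates at 0, the two densities are the positive and the
  negative part of \<open>f\<close>. Their measures agree and are finite on all rays, hence are
  equal, and so are the densities almost everywhere. One of the two parts always vanishes, so both
  do.\<close>

lemma AE_eq_0_if_integral_Ioi_eq_0:
  fixes f :: "real \<Rightarrow> real"
  assumes f: "integrable lborel f" and zero: "\<And>x. (LINT t:{x<..}|lborel. f t) = 0"
  shows "AE t in lborel. f t = 0"
proof -
  note [measurable] = borel_measurable_integrable[OF f]
  have ioi: "emeasure (density lborel (\<lambda>t. ennreal (f t))) {x<..} =
      emeasure (density lborel (\<lambda>t. ennreal (- f t))) {x<..} \<and>
      emeasure (density lborel (\<lambda>t. ennreal (- f t))) {x<..} < \<infinity>" for x
  proof -
    define g where "g t = indicator {x<..} t * f t" for t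
    have g: "integrable lborel g"
      using integrable_mult_indicator[of "{x<..}" lborel f] f by (simp add: g_def[abs_def])
    have fin: "(\<integral>\<^sup>+ t. ennreal (g t) \<partial>lborel) < \<infinity>" "(\<integral>\<^sup>+ t. ennreal (- g t) \<partial>lborel) < \<infinity>"
      using g by (auto simp: real_integrable_def less_top)
    have "enn2real (\<integral>\<^sup>+ t. ennreal (g t) \<partial>lborel) = enn2real (\<integral>\<^sup>+ t. ennreal (- g t) \<partial>lborel)"
      using zero[of x] real_lebesgue_integral_def[OF g]
      by (simp add: set_lebesgue_integral_def g_def[symmetric])
    then have "(\<integral>\<^sup>+ t. ennreal (g t) \<partial>lborel) = (\<integral>\<^sup>+ t. ennreal (- g t) \<partial>lborel)"
      using fin by (metis ennreal_enn2real infinity_ennreal_def)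
    moreover have "emeasure (density lborel (\<lambda>t. ennreal (f t))) {x<..} = (\<integral>\<^sup>+ t. ennreal (g t) \<partial>lborel)"
      by (subst emeasure_density) (auto simp: g_def intro!: nn_integral_cong split: split_indicator)
    moreover have "emeasure (density lborel (\<lambda>t. ennreal (- f t))) {x<..} = (\<integral>\<^sup>+ t. ennreal (- g t) \<partial>lborel)"
      by (subst emeasure_density) (auto simp: g_def intro!: nn_integral_cong split: split_indicator)
    ultimately show ?thesis using fin by simp
  qed
  have "density lborel (\<lambda>t. ennreal (f t)) = density lborel (\<lambda>t. ennreal (- f t))"
    by (rule measure_eqI_lessThan) (simp_all add: ioi flip: infinity_ennreal_def)
  then have "AE t in lborel. ennreal (f t) = ennreal (- f t)"
    by (intro sigma_finite_measure.density_unique[OF sigma_finite_lborel]) auto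
  then show ?thesis
    by eventually_elim (metis add.inverse_inverse add.inverse_neutral ennreal_eq_0_iff ennreal_inj
        linorder_le_cases neg_le_0_iff_le order_antisym)
qed

section \<open>Primitives of locally integrable functions on the half-line\<close>

definition locally_integrable_Ioi :: "(real \<Rightarrow> real) \<Rightarrow> bool" where
  "locally_integrable_Ioi f \<longleftrightarrow> (\<forall>a b. 0 < a \<longrightarrow> set_integrable lborel {a..b} f)"

lemma locally_integrable_IoiD:
  "locally_integrable_Ioi f \<Longrightarrow> 0 < a \<Longrightarrow> set_integrable lborel {a..b} f"
  by (simp add: locally_integrable_Ioi_def)

text \<open>Local absolute continuity, expressed through the integral formula. The function
  \<open>g\<close> matters only up to null sets, and pointwise derivatives of \<open>W\<close> never
  have to be discussed.\<close>

definition primitive_Ioi :: "(real \<Rightarrow> real) \<Rightarrow> (real \<Rightarrow> real) \<Rightarrow> bool" where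
  "primitive_Ioi W g \<longleftrightarrow> locally_integrable_Ioi g \<and>
     (\<forall>x y. 0 < x \<longrightarrow> x \<le> y \<longrightarrow> W y - W x = (LINT t:{x..y}|lborel. g t))"

lemma primitive_IoiD:
  assumes "primitive_Ioi W g"
  shows "locally_integrable_Ioi g"
    and "0 < x \<Longrightarrow> x \<le> y \<Longrightarrow> W y - W x = (LINT t:{x..y}|lborel. g t)"
  using assms by (auto simp: primitive_Ioi_def)

lemma primitive_Ioi_continuous_on:
  assumes "primitive_Ioi W g" shows "continuous_on {0<..} W"
proof -
  note prim = primitive_IoiD(2)[OF assms] and loc = primitive_IoiD(1)[OF assms]
  have "isCont W x" if "0 < x" for x
  proof -
    \<comment> \<open>This interval is a neighbourhood of \<open>x\<close> that stays away from 0,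
      near which \<open>g\<close> need not be integrable.\<close>
    have "continuous_on {x/2..x+1} (\<lambda>t. W (x/2) + integral {x/2..t} g)"
      using that
      by (intro continuous_intros indefinite_integral_continuous_1 set_borel_integral_eq_integral
          locally_integrable_IoiD[OF loc]) auto
    moreover have "W (x/2) + integral {x/2..t} g = W t" if "t \<in> {x/2..x+1}" for t
    proof -
      have "W t - W (x/2) = (LINT s:{x/2..t}|lborel. g s)"
        using \<open>0 < x\<close> that by (intro prim) auto
      also have "\<dots> = integral {x/2..t} g"
        using \<open>0 < x\<close> by (intro set_borel_integral_eq_integral locally_integrable_IoiD[OF loc]) auto
      finally show ?thesis by simp
    qed
    ultimately have "continuous_on {x/2..x+1} W" by (rule continuous_on_eq)
    then show ?thesis using that by (intro continuous_on_interior) auto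
  qed
  then show ?thesis by (intro continuous_at_imp_continuous_on) auto
qed

lemma continuous_on_Ioi_locally_integrable:
  "continuous_on {0<..} f \<Longrightarrow> locally_integrable_Ioi f"
  unfolding locally_integrable_Ioi_def
  by (auto intro!: borel_integrable_atLeastAtMost' elim: continuous_on_subset)

lemma locally_integrable_Ioi_diff:
  "locally_integrable_Ioi f \<Longrightarrow> locally_integrable_Ioi g \<Longrightarrow> locally_integrable_Ioi (\<lambda>x. f x - g x)"
  unfolding locally_integrable_Ioi_def by simp

lemma LINT_Icc_combine:
  fixes g :: "real \<Rightarrow> real"
  assumes "set_integrable lborel {x..z} g" "x \<le> y" "y \<le> z"
  shows "(LINT t:{x..z}|lborel. g t) = (LINT t:{x..y}|lborel. g t) + (LINT t:{y..z}|lborel. g t)"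
proof -
  have int: "set_integrable lborel {x..y} g" "set_integrable lborel {y..z} g"
    using assms by (auto intro: set_integrable_subset)
  show ?thesis
    using assms int
    by (simp add: set_borel_integral_eq_integral Henstock_Kurzweil_Integration.integral_combine)
qed

lemma primitive_Ioi_exists:
  assumes "locally_integrable_Ioi g"
  obtains W where "primitive_Ioi W g"
proof
  define W where "W x = (if 1 \<le> x then (LINT t:{1..x}|lborel. g t) else - (LINT t:{x..1}|lborel. g t))" for x
  have int: "set_integrable lborel {a..b} g" if "0 < a" for a b
    using assms that by (rule locally_integrable_IoiD)
  have "W y - W x = (LINT t:{x..y}|lborel. g t)" if "0 < x" "x \<le> y" for x y
  proof -
    consider "1 \<le> x" | "x < 1" "1 \<le> y" | "y < 1" by linarith
    then show ?thesis
    proof cases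
      case 1
      with that LINT_Icc_combine[OF int, of 1 x y] show ?thesis by (simp add: W_def)
    next
      case 2
      with that LINT_Icc_combine[OF int, of x 1 y] show ?thesis by (simp add: W_def)
    next
      case 3
      with that LINT_Icc_combine[OF int, of x y 1] show ?thesis by (simp add: W_def)
    qed
  qed
  then show "primitive_Ioi W g" using assms by (simp add: primitive_Ioi_def)
qed

lemma set_integrable_mult_continuous:
  fixes f \<phi> :: "real \<Rightarrow> real"
  assumes f: "set_integrable lborel {a..b} f" and \<phi>: "continuous_on {a..b} \<phi>"
  shows "set_integrable lborel {a..b} (\<lambda>x. f x * \<phi> x)"
proof -
  have "compact (\<phi> ` {a..b})" by (rule compact_continuous_image[OF \<phi>]) simp
  then obtain B where B: "\<And>x. x \<in> {a..b} \<Longrightarrow> \<bar>\<phi> x\<bar> \<le> B"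
    by (metis bounded_real compact_imp_bounded imageI)
  have [measurable]: "(\<lambda>x. indicator {a..b} x * \<phi> x) \<in> borel_measurable borel"
    using borel_measurable_continuous_on_indicator[OF _ \<phi>] by simp
  have [measurable]: "(\<lambda>x. indicator {a..b} x * f x) \<in> borel_measurable borel"
    using borel_measurable_integrable[OF f[unfolded set_integrable_def]] by simp
  have "integrable lborel (\<lambda>x. (indicator {a..b} x * f x) * (indicator {a..b} x * \<phi> x))"
  proof (rule Bochner_Integration.integrable_bound)
    show "integrable lborel (\<lambda>x. B * (indicator {a..b} x * f x))"
      using f by (auto simp: set_integrable_def)
    show "AE x in lborel. norm (indicator {a..b} x * f x * (indicator {a..b} x * \<phi> x))
        \<le> norm (B * (indicator {a..b} x * f x))"
      using order_trans[OF B abs_ge_self]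
      by (intro AE_I2) (auto simp: abs_mult mult.commute intro!: mult_right_mono split: split_indicator)
  qed measurable
  moreover have "(indicator {a..b} x * f x) * (indicator {a..b} x * \<phi> x) =
      indicator {a..b} x *\<^sub>R (f x * \<phi> x)" for x
    by (simp split: split_indicator)
  ultimately show ?thesis by (simp only: set_integrable_def)
qed

lemma integrable_mult_continuous_compact_support:
  fixes f \<phi> :: "real \<Rightarrow> real"
  assumes f: "set_integrable lborel {a..b} f" and \<phi>: "continuous_on UNIV \<phi>"
    and supp: "\<And>x. x \<notin> {a..b} \<Longrightarrow> \<phi> x = 0"
  shows "integrable lborel (\<lambda>x. f x * \<phi> x)"
proof -
  have "set_integrable lborel {a..b} (\<lambda>x. f x * \<phi> x)"
    by (intro set_integrable_mult_continuous f continuous_on_subset[OF \<phi>]) simp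
  moreover have "indicator {a..b} x *\<^sub>R (f x * \<phi> x) = f x * \<phi> x" for x
    using supp[of x] by (simp split: split_indicator)
  ultimately show ?thesis by (simp only: set_integrable_def)
qed

text \<open>Bumps are admissible and converge to indicators, so \<open>h\<close> has integral 0 over
  every bounded interval in the half-line with positive left end. Cutting \<open>h\<close> off to
  \<open>{1 / Suc n<..<Suc n}\<close> makes it integrable on the whole line, and a ray meets such an
  interval in another interval, so the criterion on rays applies. These intervals exhaust the
  half-line.\<close>

lemma fundamental_lemma_Ioi:
  assumes h: "locally_integrable_Ioi h"
    and zero: "\<And>\<phi> a b. 0 < a \<Longrightarrow> a < b \<Longrightarrow> smooth \<phi> \<Longrightarrow> (\<And>x. x \<notin> {a<..<b} \<Longrightarrow> \<phi> x = 0) \<Longrightarrow>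
      (LINT s|lborel. h s * \<phi> s) = 0"
  shows "AE s in lborel. 0 < s \<longrightarrow> h s = 0"
proof -
  have Ioo: "(LINT s|lborel. h s * indicator {a<..<b} s) = 0" if ab: "0 < a" for a b
  proof (cases "a < b")
    case True
    have hab: "set_integrable lborel {a..b} h" using h ab by (rule locally_integrable_IoiD)
    have int: "integrable lborel (\<lambda>s. h s * bump a b n s)" for n
      by (rule integrable_mult_continuous_compact_support[OF hab smooth_continuous_on[OF smooth_bump]])
        (auto intro: bump_eq_0)
    have "set_integrable lborel {a<..<b} h" by (rule set_integrable_subset[OF hab]) auto
    then have int': "integrable lborel (\<lambda>s. h s * indicator {a<..<b} s)"
      by (simp add: set_integrable_def mult.commute)
    have "(\<lambda>n. LINT s|lborel. h s * bump a b n s) \<longlonglongrightarrow> (LINT s|lborel. h s * indicator {a<..<b} s)"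
    proof (rule integral_dominated_convergence)
      show "integrable lborel (\<lambda>s. norm (h s * indicator {a<..<b} s))"
        using int' by (rule integrable_norm)
      show "AE s in lborel. (\<lambda>n. h s * bump a b n s) \<longlonglongrightarrow> h s * indicator {a<..<b} s"
        by (intro AE_I2 tendsto_mult tendsto_const bump_tendsto_indicator)
      show "AE s in lborel. norm (h s * bump a b n s) \<le> norm (h s * indicator {a<..<b} s)" for n
        using bump_nonneg[of a b n] bump_le_1[of a b n] bump_eq_0[of _ a b n]
        by (intro AE_I2) (auto simp: abs_mult mult_left_le split: split_indicator)
    qed (use int int' in \<open>auto intro: borel_measurable_integrable\<close>)
    moreover have "(LINT s|lborel. h s * bump a b n s) = 0" for n
      using ab True by (intro zero smooth_bump bump_eq_0) auto
    ultimately show ?thesis by (simp add: LIMSEQ_const_iff)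
  qed simp
  have "AE s in lborel. h s * indicator {1 / Suc n<..<Suc n} s = 0" for n :: nat
  proof (rule AE_eq_0_if_integral_Ioi_eq_0)
    have "set_integrable lborel {1 / Suc n<..<Suc n} h"
      by (rule set_integrable_subset[OF locally_integrable_IoiD[OF h, of "1 / Suc n" "Suc n"]]) auto
    then show "integrable lborel (\<lambda>s. h s * indicator {1 / Suc n<..<Suc n} s)"
      by (simp add: set_integrable_def mult.commute)
    fix x
    have "(LINT t:{x<..}|lborel. h t * indicator {1 / Suc n<..<Suc n} t) =
        (LINT t|lborel. h t * indicator {max x (1 / Suc n)<..<Suc n} t)"
      unfolding set_lebesgue_integral_def
      by (intro Bochner_Integration.integral_cong) (auto split: split_indicator)
    also have "\<dots> = 0" by (rule Ioo) (auto simp: less_max_iff_disj)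
    finally show "(LINT t:{x<..}|lborel. h t * indicator {1 / Suc n<..<Suc n} t) = 0" .
  qed
  then have "AE s in lborel. \<forall>n::nat. h s * indicator {1 / Suc n<..<Suc n} s = 0"
    unfolding AE_all_countable by blast
  then show ?thesis
  proof (eventually_elim, intro impI)
    fix s :: real assume *: "\<forall>n::nat. h s * indicator {1 / Suc n<..<Suc n} s = 0" and s: "0 < s"
    obtain n1 n2 :: nat where n: "1 / s < n1" "s < n2" using reals_Archimedean2 by meson
    define n where "n = max n1 n2"
    have "1 / s < Suc n" "s < Suc n" using n by (auto simp: n_def)
    then have "s \<in> {1 / Suc n<..<Suc n}" using s by (auto simp: field_simps)
    with * show "h s = 0" by (metis indicator_simps(1) mult.right_neutral)
  qed
qed

lemma deriv_eq_0_outside: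
  fixes \<phi> :: "real \<Rightarrow> real"
  assumes "\<And>x. x \<notin> {a<..<b} \<Longrightarrow> \<phi> x = 0" "x \<notin> {a..b}"
  shows "deriv \<phi> x = 0"
proof -
  have "eventually (\<lambda>y. \<phi> y = 0) (nhds x)"
    using assms by (intro eventually_mono[OF eventually_nhds_in_open[of "- {a..b}"]]) auto
  then have "(\<phi> has_real_derivative 0) (at x)"
    by (subst DERIV_cong_ev[where g = "\<lambda>_. 0"]) auto
  then show ?thesis by (rule DERIV_imp_deriv)
qed

text \<open>Fubini for \<open>deriv \<phi> s * g t\<close> on the triangle \<open>t \<le> s\<close>:
  integrating in \<open>t\<close> gives \<open>(W s - W a) * deriv \<phi> s\<close>, integrating in
  \<open>s\<close> gives \<open>- g t * \<phi> t\<close> because \<open>\<phi> b = 0\<close>. The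
  term with \<open>W a\<close> drops out since \<open>deriv \<phi>\<close> has integral 0.\<close>

lemma primitive_Ioi_integration_by_parts:
  assumes W: "primitive_Ioi W g" and \<phi>: "smooth \<phi>" and ab: "0 < a" "a < b"
    and supp: "\<And>x. x \<notin> {a<..<b} \<Longrightarrow> \<phi> x = 0"
  shows "(LINT s|lborel. W s * deriv \<phi> s) = - (LINT s|lborel. g s * \<phi> s)"
proof -
  define G where "G t = indicator {a..b} t * g t" for t
  define D where "D s = indicator {a..b} s * deriv \<phi> s" for s
  define k where "k p = indicator {(s, t). t \<le> s} p *\<^sub>R (D (fst p) * G (snd p))" for p
  have g: "set_integrable lborel {a..b} g"
    using primitive_IoiD(1)[OF W] ab(1) by (rule locally_integrable_IoiD)
  have G: "integrable lborel G" using g by (simp add: G_def[abs_def] set_integrable_def)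
  have contD: "continuous_on A (deriv \<phi>)" for A
    by (intro smooth_continuous_on smooth_deriv \<phi>)
  have D: "integrable lborel D"
    using borel_integrable_atLeastAtMost'[OF contD[of "{a..b}"]]
    by (simp add: D_def[abs_def] set_integrable_def)
  note [measurable] = borel_measurable_integrable[OF G] borel_measurable_integrable[OF D]
  have FTC: "(LINT s:{x..y}|lborel. deriv \<phi> s) = \<phi> y - \<phi> x" if "x \<le> y" for x y
    unfolding set_lebesgue_integral_def real_scaleR_def
    using integral_FTC_Icc_real[OF that smooth_has_deriv[OF \<phi>], of] contD[of UNIV]
    by (simp add: mult.commute continuous_on_eq_continuous_at)
  have DG: "integrable (lborel \<Otimes>\<^sub>M lborel) (\<lambda>(s, t). D s * G t)"
  proof (rule lborel_pair.Fubini_integrable)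
    show "integrable lborel (\<lambda>x. LINT y|lborel. norm (case (x, y) of (s, t) \<Rightarrow> D s * G t))"
      using D G by (simp add: abs_mult)
    show "AE x in lborel. integrable lborel (\<lambda>y. case (x, y) of (s, t) \<Rightarrow> D s * G t)"
      using G by simp
  qed measurable
  have k: "integrable (lborel \<Otimes>\<^sub>M lborel) k"
  proof -
    have "closed {(s, t). t \<le> (s::real)}"
      unfolding case_prod_beta by (intro closed_Collect_le continuous_intros)
    then have [measurable]: "{(s, t). t \<le> (s::real)} \<in> sets (lborel \<Otimes>\<^sub>M lborel)"
      unfolding lborel_prod sets_lborel by (rule borel_closed)
    have "integrable (lborel \<Otimes>\<^sub>M lborel) (\<lambda>p. indicator {(s, t). t \<le> s} p *\<^sub>R (case p of (s, t) \<Rightarrow> D s * G t))"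
      by (rule integrable_mult_indicator[OF _ DG]) measurable
    then show ?thesis by (simp only: k_def[abs_def] case_prod_beta)
  qed
  have inner1: "(LINT t|lborel. k (s, t)) = W s * D s - W a * D s" for s
  proof (cases "s \<in> {a..b}")
    case True
    have "(LINT t|lborel. k (s, t)) = (LINT t|lborel. D s * (indicator {a..s} t * g t))"
      using True by (intro Bochner_Integration.integral_cong) (auto simp: k_def G_def split: split_indicator)
    also have "\<dots> = D s * (LINT t:{a..s}|lborel. g t)"
      by (simp add: set_lebesgue_integral_def)
    also have "(LINT t:{a..s}|lborel. g t) = W s - W a"
      using True ab by (simp add: primitive_IoiD(2)[OF W])
    finally show ?thesis by (simp add: algebra_simps)
  qed (simp add: k_def D_def)
  have inner2: "(LINT s|lborel. k (s, t)) = - (g t * \<phi> t)" for t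
  proof (cases "t \<in> {a..b}")
    case True
    have "(LINT s|lborel. k (s, t)) = (LINT s|lborel. g t * (indicator {t..b} s * deriv \<phi> s))"
      using True by (intro Bochner_Integration.integral_cong) (auto simp: k_def G_def D_def split: split_indicator)
    also have "\<dots> = g t * (LINT s:{t..b}|lborel. deriv \<phi> s)"
      by (simp add: set_lebesgue_integral_def)
    also have "(LINT s:{t..b}|lborel. deriv \<phi> s) = \<phi> b - \<phi> t" using True by (intro FTC) auto
    finally show ?thesis using supp[of b] by simp
  qed (use supp in \<open>auto simp: k_def G_def\<close>)
  have LD: "(LINT s|lborel. W s * D s - W a * D s) = - (LINT t|lborel. g t * \<phi> t)"
    using lborel_pair.integral_fst'[OF k] lborel_pair.integral_snd[of "curry k"] k
    by (simp add: inner1 inner2)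
  have WD: "W s * deriv \<phi> s = W s * D s" for s
    using deriv_eq_0_outside[OF supp] by (auto simp: D_def split: split_indicator)
  have "integrable lborel (\<lambda>s. W s * D s)"
  proof -
    have "locally_integrable_Ioi W"
      by (rule continuous_on_Ioi_locally_integrable[OF primitive_Ioi_continuous_on[OF W]])
    then have "integrable lborel (\<lambda>s. W s * deriv \<phi> s)"
      using ab contD supp
      by (intro integrable_mult_continuous_compact_support[of a b] deriv_eq_0_outside[of a b])
        (auto dest: locally_integrable_IoiD)
    then show ?thesis by (simp only: WD)
  qed
  moreover have "(LINT s|lborel. D s) = 0"
    using FTC[of a b] ab supp[of a] supp[of b] by (simp add: D_def[abs_def] set_lebesgue_integral_def)
  ultimately show ?thesis using D LD by (simp add: WD)
qed

text \<open>The difference \<open>w\<close> of \<open>u\<close> and a primitive \<open>V\<close> of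
  \<open>g\<close> annihilates all derivatives of test functions, and these are exactly the test
  functions of integral 0. Correcting an arbitrary \<open>\<psi>\<close> by a multiple of one fixed
  bump gives it integral 0, which shows that \<open>w\<close> is a constant almost
  everywhere.\<close>

lemma du_Bois_Reymond_Ioi:
  assumes u: "locally_integrable_Ioi u" and g: "locally_integrable_Ioi g"
    and weak: "\<And>\<phi> a b. 0 < a \<Longrightarrow> a < b \<Longrightarrow> smooth \<phi> \<Longrightarrow> (\<And>x. x \<notin> {a<..<b} \<Longrightarrow> \<phi> x = 0) \<Longrightarrow>
      (LINT s|lborel. u s * deriv \<phi> s) = - (LINT s|lborel. g s * \<phi> s)"
  obtains W where "primitive_Ioi W g" and "AE s in lborel. 0 < s \<longrightarrow> u s = W s"
proof -
  obtain V where V: "primitive_Ioi V g" using primitive_Ioi_exists[OF g] .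
  define w where "w s = u s - V s" for s
  have locV: "locally_integrable_Ioi V"
    by (rule continuous_on_Ioi_locally_integrable[OF primitive_Ioi_continuous_on[OF V]])
  have w: "locally_integrable_Ioi w"
    unfolding w_def using u locV by (rule locally_integrable_Ioi_diff)
  have int: "integrable lborel (\<lambda>s. f s * \<psi> s)"
    if "locally_integrable_Ioi f" "0 < a" "smooth \<psi>" "\<And>x. x \<notin> {a..b} \<Longrightarrow> \<psi> x = 0" for f \<psi> a b
    using that by (intro integrable_mult_continuous_compact_support[of a b])
      (auto intro: locally_integrable_IoiD smooth_continuous_on)
  have int1: "integrable lborel \<psi>"
    if "0 < a" "smooth \<psi>" "\<And>x. x \<notin> {a..b} \<Longrightarrow> \<psi> x = 0" for \<psi> a b
    using int[of "\<lambda>_. 1", OF _ that] by (simp add: continuous_on_Ioi_locally_integrable)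
  have w_deriv: "(LINT s|lborel. w s * deriv \<phi> s) = 0"
    if "0 < a" "a < b" "smooth \<phi>" "\<And>x. x \<notin> {a<..<b} \<Longrightarrow> \<phi> x = 0" for \<phi> a b
  proof -
    have "integrable lborel (\<lambda>s. u s * deriv \<phi> s)" "integrable lborel (\<lambda>s. V s * deriv \<phi> s)"
      using u locV that deriv_eq_0_outside[OF that(4)] by (auto intro!: int[of _ a _ b] smooth_deriv)
    then show ?thesis
      using weak[OF that] primitive_Ioi_integration_by_parts[OF V that(3,1,2,4)]
      by (simp add: w_def left_diff_distrib)
  qed
  define \<psi>\<^sub>0 where "\<psi>\<^sub>0 = bump 1 2 1"
  define I\<^sub>0 where "I\<^sub>0 = (LINT s|lborel. \<psi>\<^sub>0 s)"
  \<comment> \<open>The only candidate for the constant: testing \<open>w = c\<close> against the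
    fixed bump forces this quotient.\<close>
  define c where "c = (LINT s|lborel. w s * \<psi>\<^sub>0 s) / I\<^sub>0"
  have \<psi>\<^sub>0: "smooth \<psi>\<^sub>0" "\<And>x. x \<notin> {1<..<2} \<Longrightarrow> \<psi>\<^sub>0 x = 0"
    by (auto simp: \<psi>\<^sub>0_def smooth_bump intro!: bump_eq_0)
  have int\<psi>\<^sub>0: "integrable lborel \<psi>\<^sub>0" using \<psi>\<^sub>0 by (intro int1[of 1 _ 2]) auto
  have "I\<^sub>0 \<noteq> 0"
  proof
    assume "I\<^sub>0 = 0"
    then have "AE s in lborel. \<psi>\<^sub>0 s = 0"
      using integral_nonneg_eq_0_iff_AE[OF int\<psi>\<^sub>0] by (simp add: I\<^sub>0_def \<psi>\<^sub>0_def bump_nonneg)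
    then have "AE s in lborel. s \<notin> {1<..<2::real}"
      by eventually_elim (use bump_pos[of 1 _ 1 2] in \<open>force simp: \<psi>\<^sub>0_def\<close>)
    then have "{1<..<2::real} \<in> null_sets lborel" by (subst AE_iff_null_sets) auto
    then show False by (simp add: null_sets_def)
  qed
  have "AE s in lborel. 0 < s \<longrightarrow> w s - c = 0"
  proof (rule fundamental_lemma_Ioi)
    show "locally_integrable_Ioi (\<lambda>s. w s - c)"
      by (intro locally_integrable_Ioi_diff w continuous_on_Ioi_locally_integrable continuous_intros)
    fix \<psi> :: "real \<Rightarrow> real" and a b
    assume ab: "0 < a" "a < b" and \<psi>: "smooth \<psi>" "\<And>x. x \<notin> {a<..<b} \<Longrightarrow> \<psi> x = 0"
    define I where "I = (LINT s|lborel. \<psi> s)"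
    define \<theta> where "\<theta> s = \<psi> s + (- (I / I\<^sub>0)) * \<psi>\<^sub>0 s" for s
    \<comment> \<open>The hull of the support interval of \<open>\<psi>\<close> and that of the
      fixed bump, so that it contains the support of \<open>\<theta>\<close>.\<close>
    define a' b' where "a' = min a 1" and "b' = max b 2"
    have ab': "0 < a'" "a' < b'" using ab by (auto simp: a'_def b'_def)
    have \<theta>: "smooth \<theta>" unfolding \<theta>_def by (intro smooth_add smooth_mult smooth_const \<psi> \<psi>\<^sub>0)
    have \<theta>0: "\<theta> x = 0" if "x \<notin> {a'<..<b'}" for x
    proof -
      have "\<psi> x = 0" "\<psi>\<^sub>0 x = 0"
        using that by (auto intro!: \<psi>(2) \<psi>\<^sub>0(2) simp: a'_def b'_def)
      then show ?thesis by (simp add: \<theta>_def)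
    qed
    have int\<psi>: "integrable lborel \<psi>" using ab \<psi> by (intro int1[of a _ b]) auto
    have \<theta>_integral: "(LINT s|lborel. \<theta> s) = 0"
      using int\<psi> int\<psi>\<^sub>0 \<open>I\<^sub>0 \<noteq> 0\<close> by (simp add: \<theta>_def I_def[symmetric] I\<^sub>0_def[symmetric])
    have cont: "isCont \<theta> x" for x using smooth_has_deriv[OF \<theta>] by (rule DERIV_isCont)
    obtain F where F: "\<And>x. (F has_real_derivative \<theta> x) (at x)"
      using einterval_antiderivative[of "-\<infinity>" \<infinity> \<theta>] cont
      by (auto simp: has_real_derivative_iff_has_vector_derivative)
    \<comment> \<open>Normalised to vanish at \<open>a'\<close>, hence to the left of it; to the
      right of \<open>b'\<close> it vanishes because \<open>\<theta>\<close> has integral 0. So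
      \<open>\<phi>\<close> is itself a test function.\<close>
    define \<phi> where "\<phi> x = F x - F a'" for x
    have \<phi>': "(\<phi> has_real_derivative \<theta> x) (at x)" for x
      unfolding \<phi>_def by (rule derivative_eq_intros F refl)+ simp
    have FTC: "(LINT s|lborel. \<theta> s * indicator {x..y} s) = F y - F x" if "x \<le> y" for x y
      using integral_FTC_Icc_real[OF that F cont] .
    have \<phi>0: "\<phi> x = 0" if "x \<notin> {a'<..<b'}" for x
    proof (cases "x \<le> a'")
      case True
      have "\<theta> s * indicator {x..a'} s = 0" for s
        using \<theta>0 by (auto split: split_indicator)
      then show ?thesis using FTC[OF True] by (simp only: \<phi>_def) simp
    next
      case False
      have "(LINT s|lborel. \<theta> s * indicator {a'..x} s) = (LINT s|lborel. \<theta> s)"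
        using that False
        by (intro Bochner_Integration.integral_cong) (use \<theta>0 in \<open>auto split: split_indicator\<close>)
      then show ?thesis using FTC[of a' x] False \<theta>_integral by (simp add: \<phi>_def)
    qed
    have "deriv \<phi> = \<theta>" using \<phi>' by (auto intro: DERIV_imp_deriv)
    then have "(LINT s|lborel. w s * \<theta> s) = 0"
      using w_deriv[OF ab' smooth_antiderivative[OF \<theta> \<phi>'] \<phi>0] by simp
    moreover have "integrable lborel (\<lambda>s. w s * \<psi> s)"
      by (rule int[OF w ab(1) \<psi>(1), of b]) (rule \<psi>(2), auto)
    moreover have "integrable lborel (\<lambda>s. w s * \<psi>\<^sub>0 s)"
      by (rule int[OF w zero_less_one \<psi>\<^sub>0(1), of 2]) (rule \<psi>\<^sub>0(2), auto)
    ultimately have "(LINT s|lborel. w s * \<psi> s) = c * I"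
      by (simp add: \<theta>_def distrib_left c_def algebra_simps)
    then show "(LINT s|lborel. (w s - c) * \<psi> s) = 0"
      using \<open>integrable lborel (\<lambda>s. w s * \<psi> s)\<close> int\<psi> by (simp add: left_diff_distrib I_def)
  qed
  then have "AE s in lborel. 0 < s \<longrightarrow> u s = V s + c"
    by eventually_elim (auto simp: w_def)
  moreover have "primitive_Ioi (\<lambda>s. V s + c) g" using V by (simp add: primitive_Ioi_def)
  ultimately show thesis using that by blast
qed

subsection \<open>Moments of the weight\<close>

lemma gauss_weight_pos: "0 < s \<Longrightarrow> 0 < gauss_weight \<alpha> s"
  by (simp add: gauss_weight_def)

lemma gauss_weight_nonneg: "0 \<le> gauss_weight \<alpha> s"
  by (simp add: gauss_weight_def)

lemma measurable_gauss_weight [measurable]: "gauss_weight \<alpha> \<in> borel_measurable borel"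
  unfolding gauss_weight_def[abs_def] by measurable

lemma continuous_on_gauss_weight: "continuous_on {0<..} (gauss_weight \<alpha>)"
  unfolding gauss_weight_def[abs_def] by (auto intro!: continuous_intros)

text \<open>The even moments of the weight, and their finiteness, follow from lower moments by
  shifting the parameter by 2.\<close>

lemma gauss_weight_add_2: "0 < s \<Longrightarrow> gauss_weight (\<alpha> + 2) s = s\<^sup>2 * gauss_weight \<alpha> s"
  using powr_add[of s "\<alpha> - 1" 2] by (simp add: gauss_weight_def algebra_simps)

lemma gauss_weight_integrable:
  assumes "0 < \<alpha>" shows "set_integrable lborel {0<..} (gauss_weight \<alpha>)"
  unfolding set_integrable_def
proof (rule integrableI_nonneg)
  have le: "gauss_weight \<alpha> s \<le> exp (1 / 2) * (s powr (\<alpha> - 1) / exp s)" if "0 < s" for s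
  proof -
    \<comment> \<open>Completing the square bounds the Gaussian by a multiple of
      \<open>exp (- s)\<close>, which leaves the integral of \<open>Gamma \<alpha>\<close>.\<close>
    have "0 \<le> (s - 1)\<^sup>2" by simp
    then have "- (s\<^sup>2) / 2 \<le> 1 / 2 - s" by (simp add: power2_eq_square algebra_simps)
    then have "exp (- (s\<^sup>2) / 2) \<le> exp (1 / 2 - s)" by simp
    then have "exp (- (s\<^sup>2) / 2) * s powr (\<alpha> - 1) \<le> exp (1 / 2 - s) * s powr (\<alpha> - 1)"
      by (rule mult_right_mono) simp
    then show ?thesis by (simp add: gauss_weight_def exp_diff)
  qed
  have "(\<integral>\<^sup>+ s. ennreal (indicator {0<..} s *\<^sub>R gauss_weight \<alpha> s) \<partial>lborel) \<le>
      (\<integral>\<^sup>+ s. ennreal (exp (1 / 2)) * ennreal (indicator {0..} s * s powr (\<alpha> - 1) / exp s) \<partial>lborel)"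
    using le by (intro nn_integral_mono)
      (auto simp: ennreal_mult[symmetric] intro!: ennreal_leI split: split_indicator)
  also have "\<dots> = ennreal (exp (1 / 2)) * ennreal (Gamma \<alpha>)"
    using Gamma_conv_nn_integral_real[OF assms] by (subst nn_integral_cmult) auto
  also have "\<dots> < \<infinity>" by (simp add: ennreal_mult_less_top)
  finally show "(\<integral>\<^sup>+ s. ennreal (indicator {0<..} s *\<^sub>R gauss_weight \<alpha> s) \<partial>lborel) < \<infinity>" .
qed (auto simp: gauss_weight_nonneg)

lemma gauss_weight_square_integrable:
  assumes "0 < \<alpha>" shows "set_integrable lborel {0<..} (\<lambda>s. s\<^sup>2 * gauss_weight \<alpha> s)"
  using gauss_weight_integrable[of "\<alpha> + 2"] assms
  by (subst set_integrable_cong[OF refl refl gauss_weight_add_2[symmetric]]) auto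

lemma gauss_weight_power4_integrable:
  assumes "0 < \<alpha>" shows "set_integrable lborel {0<..} (\<lambda>s. s ^ 4 * gauss_weight \<alpha> s)"
proof -
  have "s ^ 4 * gauss_weight \<alpha> s = s\<^sup>2 * gauss_weight (\<alpha> + 2) s" if "0 < s" for s
    using gauss_weight_add_2[OF that, of \<alpha>] by (simp add: power2_eq_square power4_eq_xxxx)
  then show ?thesis
    using gauss_weight_square_integrable[of "\<alpha> + 2"] assms
    by (subst set_integrable_cong[OF refl refl, of _ _ "\<lambda>s. s\<^sup>2 * gauss_weight (\<alpha> + 2) s"]) auto
qed

text \<open>The differentiated function is \<open>s * gauss_weight \<alpha> s\<close> in a form with
  exponent \<alpha> > 0, from which the limit 0 at the origin can be read off.\<close>

lemma gauss_weight_first_integral_DERIV: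
  assumes "0 < s"
  shows "((\<lambda>s. s powr \<alpha> * exp (- (s\<^sup>2) / 2)) has_real_derivative
    (\<alpha> - s\<^sup>2) * gauss_weight \<alpha> s) (at s)"
proof -
  have "s powr \<alpha> = s * s powr (\<alpha> - 1)" using assms powr_add[of s 1 "\<alpha> - 1"] by simp
  moreover have "((\<lambda>s. s powr \<alpha> * exp (- (s\<^sup>2) / 2)) has_real_derivative
      (\<alpha> * s powr (\<alpha> - 1)) * exp (- (s\<^sup>2) / 2) + (exp (- (s\<^sup>2) / 2) * (- s)) * s powr \<alpha>) (at s)"
    by (intro DERIV_mult has_real_derivative_powr assms) (auto intro!: derivative_eq_intros)
  ultimately show ?thesis
    by (simp add: gauss_weight_def power2_eq_square algebra_simps)
qed

lemma gauss_weight_first_integral_eq: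
  "0 < s \<Longrightarrow> s powr \<alpha> * exp (- (s\<^sup>2) / 2) = s * gauss_weight \<alpha> s"
  using powr_add[of s 1 "\<alpha> - 1"] by (simp add: gauss_weight_def)

lemma gauss_weight_first_integral_at_0:
  assumes "0 < \<alpha>"
  shows "((\<lambda>s. s powr \<alpha> * exp (- (s\<^sup>2) / 2)) \<longlongrightarrow> 0) (at_right (0::real))"
  using assms by real_asymp

lemma gauss_weight_first_integral_at_top:
  "((\<lambda>s::real. s powr \<alpha> * exp (- (s\<^sup>2) / 2)) \<longlongrightarrow> 0) at_top"
  by real_asymp

lemma gauss_weight_centered_integrable:
  assumes "0 < \<alpha>" "A \<in> sets borel" "A \<subseteq> {0<..}"
  shows "set_integrable lborel A (\<lambda>s. (\<alpha> - s\<^sup>2) * gauss_weight \<alpha> s)"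
proof (rule set_integrable_subset)
  show "set_integrable lborel {0<..} (\<lambda>s. (\<alpha> - s\<^sup>2) * gauss_weight \<alpha> s)"
    unfolding left_diff_distrib
    using assms(1) by (intro set_integral_diff set_integrable_mult_right
      gauss_weight_integrable gauss_weight_square_integrable)
qed (use assms in auto)

text \<open>Extended real endpoints and boundary limits \<open>A\<close>, \<open>B\<close> let one
  application of the fundamental theorem serve the interval below a point, the ray above it and the
  whole half-line.\<close>

lemma gauss_weight_centered_LBINT:
  fixes a b :: ereal
  assumes "0 < \<alpha>" "0 \<le> a" "a < b"
    and "(((\<lambda>s. s powr \<alpha> * exp (- (s\<^sup>2) / 2)) \<circ> real_of_ereal) \<longlongrightarrow> A) (at_right a)"
    and "(((\<lambda>s. s powr \<alpha> * exp (- (s\<^sup>2) / 2)) \<circ> real_of_ereal) \<longlongrightarrow> B) (at_left b)"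
  shows "(LINT s:einterval a b|lborel. (\<alpha> - s\<^sup>2) * gauss_weight \<alpha> s) = B - A"
proof -
  have pos: "0 < s" if "a < ereal s" for s
    using assms(2) that by (metis ereal_less(2) order_le_less_trans)
  have "(LBINT s=a..b. (\<alpha> - s\<^sup>2) * gauss_weight \<alpha> s) = B - A"
  proof (rule interval_integral_FTC_integrable[OF assms(3) _ _ _ assms(4,5)])
    fix s assume "a < ereal s"
    then have "0 < s" by (rule pos)
    then show "((\<lambda>s. s powr \<alpha> * exp (- (s\<^sup>2) / 2)) has_vector_derivative
        (\<alpha> - s\<^sup>2) * gauss_weight \<alpha> s) (at s)"
      using gauss_weight_first_integral_DERIV
      by (simp add: has_real_derivative_iff_has_vector_derivative)
    show "isCont (\<lambda>s. (\<alpha> - s\<^sup>2) * gauss_weight \<alpha> s) s"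
      using \<open>0 < s\<close> continuous_on_gauss_weight[of \<alpha>]
      by (intro continuous_intros) (simp add: continuous_on_eq_continuous_at)
  next
    show "set_integrable lborel (einterval a b) (\<lambda>s. (\<alpha> - s\<^sup>2) * gauss_weight \<alpha> s)"
      using assms(1) pos by (intro gauss_weight_centered_integrable) (auto simp: einterval_def)
  qed
  then show ?thesis using assms(3) by (simp add: interval_lebesgue_integral_def less_imp_le)
qed

lemma gauss_weight_centered_below:
  assumes "0 < \<alpha>" "0 < t"
  shows "(LINT s:{0<..<t}|lborel. (\<alpha> - s\<^sup>2) * gauss_weight \<alpha> s) = t * gauss_weight \<alpha> t"
proof -
  have "(LINT s:einterval 0 (ereal t)|lborel. (\<alpha> - s\<^sup>2) * gauss_weight \<alpha> s) =
      t powr \<alpha> * exp (- (t\<^sup>2) / 2) - 0"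
  proof (rule gauss_weight_centered_LBINT)
    show "(((\<lambda>s. s powr \<alpha> * exp (- (s\<^sup>2) / 2)) \<circ> real_of_ereal) \<longlongrightarrow> 0) (at_right 0)"
      using gauss_weight_first_integral_at_0[OF assms(1)]
      unfolding zero_ereal_def by (simp only: ereal_tendsto_simps)
    have "isCont (\<lambda>s. s powr \<alpha> * exp (- (s\<^sup>2) / 2)) t"
      using gauss_weight_first_integral_DERIV[OF assms(2)] by (rule DERIV_isCont)
    then show "(((\<lambda>s. s powr \<alpha> * exp (- (s\<^sup>2) / 2)) \<circ> real_of_ereal) \<longlongrightarrow>
        t powr \<alpha> * exp (- (t\<^sup>2) / 2)) (at_left (ereal t))"
      by (simp only: ereal_tendsto_simps isCont_def filterlim_at_split)
  qed (use assms in auto)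
  moreover have "einterval 0 (ereal t) = {0<..<t}" by (auto simp: einterval_def)
  ultimately show ?thesis using gauss_weight_first_integral_eq[OF assms(2), of \<alpha>] by simp
qed

lemma gauss_weight_centered_above:
  assumes "0 < \<alpha>" "0 < t"
  shows "(LINT s:{t<..}|lborel. (s\<^sup>2 - \<alpha>) * gauss_weight \<alpha> s) = t * gauss_weight \<alpha> t"
proof -
  have "(LINT s:einterval (ereal t) \<infinity>|lborel. (\<alpha> - s\<^sup>2) * gauss_weight \<alpha> s) =
      0 - t powr \<alpha> * exp (- (t\<^sup>2) / 2)"
  proof (rule gauss_weight_centered_LBINT)
    show "(((\<lambda>s. s powr \<alpha> * exp (- (s\<^sup>2) / 2)) \<circ> real_of_ereal) \<longlongrightarrow> 0) (at_left \<infinity>)"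
      using gauss_weight_first_integral_at_top by (simp only: ereal_tendsto_simps)
    have "isCont (\<lambda>s. s powr \<alpha> * exp (- (s\<^sup>2) / 2)) t"
      using gauss_weight_first_integral_DERIV[OF assms(2)] by (rule DERIV_isCont)
    then show "(((\<lambda>s. s powr \<alpha> * exp (- (s\<^sup>2) / 2)) \<circ> real_of_ereal) \<longlongrightarrow>
        t powr \<alpha> * exp (- (t\<^sup>2) / 2)) (at_right (ereal t))"
      by (simp only: ereal_tendsto_simps isCont_def filterlim_at_split)
  qed (use assms in auto)
  moreover have "einterval (ereal t) \<infinity> = {t<..}" by (auto simp: einterval_def)
  moreover have "(LINT s:{t<..}|lborel. (s\<^sup>2 - \<alpha>) * gauss_weight \<alpha> s) =
      - (LINT s:{t<..}|lborel. (\<alpha> - s\<^sup>2) * gauss_weight \<alpha> s)"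
    unfolding set_lebesgue_integral_def Bochner_Integration.integral_minus[symmetric]
    by (intro Bochner_Integration.integral_cong) (auto simp: algebra_simps)
  ultimately show ?thesis using gauss_weight_first_integral_eq[OF assms(2), of \<alpha>] by simp
qed

text \<open>Both boundary values vanish: \<alpha> is the mean of \<open>s^2\<close> under the
  weight, which is why \<open>sqrt \<alpha>\<close> is the base point.\<close>

lemma gauss_weight_centered_total:
  assumes "0 < \<alpha>"
  shows "(LINT s:{0<..}|lborel. (\<alpha> - s\<^sup>2) * gauss_weight \<alpha> s) = 0"
proof -
  have "(LINT s:einterval 0 \<infinity>|lborel. (\<alpha> - s\<^sup>2) * gauss_weight \<alpha> s) = 0 - 0"
  proof (rule gauss_weight_centered_LBINT)
    show "(((\<lambda>s. s powr \<alpha> * exp (- (s\<^sup>2) / 2)) \<circ> real_of_ereal) \<longlongrightarrow> 0) (at_right 0)"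
      using gauss_weight_first_integral_at_0[OF assms(1)]
      unfolding zero_ereal_def by (simp only: ereal_tendsto_simps)
    show "(((\<lambda>s. s powr \<alpha> * exp (- (s\<^sup>2) / 2)) \<circ> real_of_ereal) \<longlongrightarrow> 0) (at_left \<infinity>)"
      using gauss_weight_first_integral_at_top by (simp only: ereal_tendsto_simps)
  qed (use assms in auto)
  moreover have "einterval 0 \<infinity> = {0<..}" by (auto simp: einterval_def)
  ultimately show ?thesis by simp
qed

lemma gauss_weight_second_moment:
  assumes "0 < \<alpha>"
  shows "(LINT s:{0<..}|lborel. s\<^sup>2 * gauss_weight \<alpha> s) = \<alpha> * (LINT s:{0<..}|lborel. gauss_weight \<alpha> s)"
  using gauss_weight_centered_total[OF assms] gauss_weight_integrable[OF assms]
    gauss_weight_square_integrable[OF assms]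
  by (simp add: left_diff_distrib set_integral_diff)

text \<open>The second moment formula is used twice, at parameter \<alpha> + 2 and at \<alpha>; this
  yields the two factors.\<close>

lemma gauss_weight_fourth_moment:
  assumes "0 < \<alpha>"
  shows "(LINT s:{0<..}|lborel. s ^ 4 * gauss_weight \<alpha> s) =
    (\<alpha> + 2) * \<alpha> * (LINT s:{0<..}|lborel. gauss_weight \<alpha> s)"
proof -
  have "(LINT s:{0<..}|lborel. s ^ 4 * gauss_weight \<alpha> s) = (LINT s:{0<..}|lborel. s\<^sup>2 * gauss_weight (\<alpha> + 2) s)"
    by (rule set_lebesgue_integral_cong)
      (auto simp: gauss_weight_add_2 power2_eq_square power4_eq_xxxx)
  also have "\<dots> = (\<alpha> + 2) * (LINT s:{0<..}|lborel. gauss_weight (\<alpha> + 2) s)"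
    using assms by (intro gauss_weight_second_moment) auto
  also have "(LINT s:{0<..}|lborel. gauss_weight (\<alpha> + 2) s) = (LINT s:{0<..}|lborel. s\<^sup>2 * gauss_weight \<alpha> s)"
    by (rule set_lebesgue_integral_cong) (auto simp: gauss_weight_add_2)
  finally show ?thesis by (simp add: gauss_weight_second_moment[OF assms])
qed

lemma gauss_weight_mass_pos:
  assumes "0 < \<alpha>" shows "0 < (LINT s:{0<..}|lborel. gauss_weight \<alpha> s)"
proof -
  note int = gauss_weight_integrable[OF assms, unfolded set_integrable_def]
  have "(LINT s:{0<..}|lborel. gauss_weight \<alpha> s) \<noteq> 0"
  proof
    assume "(LINT s:{0<..}|lborel. gauss_weight \<alpha> s) = 0"
    then have "AE s in lborel. indicator {0<..} s *\<^sub>R gauss_weight \<alpha> s = 0"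
      using integral_nonneg_eq_0_iff_AE[OF int]
      by (simp add: set_lebesgue_integral_def gauss_weight_nonneg)
    then have "AE s in lborel. s \<notin> {0<..<1::real}"
      by eventually_elim (use gauss_weight_pos[of _ \<alpha>] in \<open>force\<close>)
    then have "{0<..<1::real} \<in> null_sets lborel" by (subst AE_iff_null_sets) auto
    then show False by (simp add: null_sets_def)
  qed
  moreover have "0 \<le> (LINT s:{0<..}|lborel. gauss_weight \<alpha> s)"
    unfolding set_lebesgue_integral_def
    by (intro integral_nonneg_AE AE_I2) (simp add: gauss_weight_nonneg)
  ultimately show ?thesis by simp
qed

subsection \<open>The energy identity\<close>

text \<open>The nonnegative integral of \<open>(g t - 2 * c * t)^2 / (2 * t)\<close> is expanded
  with the best \<open>c\<close>. Written with increments, the bound is symmetric in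
  \<open>x\<close> and \<open>y\<close>, so both sides of the base point are covered at once.
  Arbitrary pairs of points are allowed because the equality case compares two points other than
  \<open>sqrt \<alpha>\<close>.\<close>

lemma primitive_Ioi_cauchy_schwarz:
  assumes U: "primitive_Ioi U g" and G: "primitive_Ioi G (\<lambda>t. (g t)\<^sup>2 / (2 * t))"
    and "0 < x" "0 < y"
  shows "(U x - U y)\<^sup>2 \<le> (x\<^sup>2 - y\<^sup>2) * (G x - G y)"
proof -
  have ordered: "(U x - U y)\<^sup>2 \<le> (x\<^sup>2 - y\<^sup>2) * (G x - G y)" if "0 < y" "y < x" for x y
  proof -
    \<comment> \<open>The minimiser of the quadratic polynomial in \<open>c\<close> below: the slope
      of \<open>U\<close> between \<open>y\<close> and \<open>x\<close> in the variable
      \<open>t^2\<close>.\<close>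
    define c where "c = (U x - U y) / (x\<^sup>2 - y\<^sup>2)"
    have pos: "0 < x\<^sup>2 - y\<^sup>2" using that by (simp add: power_strict_mono)
    have int: "set_integrable lborel {y..x} g" "set_integrable lborel {y..x} (\<lambda>t. (g t)\<^sup>2 / (2 * t))"
      using that primitive_IoiD(1)[OF U] primitive_IoiD(1)[OF G]
      by (auto dest: locally_integrable_IoiD)
    have int_id: "set_integrable lborel {y..x} (\<lambda>t. 2 * t)"
      by (intro borel_integrable_atLeastAtMost' continuous_intros)
    have "(LINT t:{y..x}|lborel. 2 * t) = x\<^sup>2 - y\<^sup>2"
    proof -
      have "(LINT t|lborel. 2 * t * indicator {y..x} t) = x\<^sup>2 - y\<^sup>2"
        using that by (intro integral_FTC_Icc_real) (auto intro!: derivative_eq_intros)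
      then show ?thesis by (simp only: set_lebesgue_integral_def real_scaleR_def mult.commute)
    qed
    then have eq: "(LINT t:{y..x}|lborel. (g t)\<^sup>2 / (2 * t) - 2 * c * g t + c\<^sup>2 * (2 * t)) =
        (G x - G y) - 2 * c * (U x - U y) + c\<^sup>2 * (x\<^sup>2 - y\<^sup>2)"
      using that int int_id primitive_IoiD(2)[OF U, of y x] primitive_IoiD(2)[OF G, of y x]
      by (simp add: set_integral_add set_integral_diff del: set_integral_mult_left)
    have "0 \<le> (LINT t:{y..x}|lborel. (g t)\<^sup>2 / (2 * t) - 2 * c * g t + c\<^sup>2 * (2 * t))"
      unfolding set_lebesgue_integral_def
    proof (intro integral_nonneg_AE AE_I2)
      fix t
      have "(g t)\<^sup>2 / (2 * t) - 2 * c * g t + c\<^sup>2 * (2 * t) = (g t - 2 * c * t)\<^sup>2 / (2 * t)" if "0 < t"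
        using that by (simp add: power2_eq_square field_simps)
      then show "0 \<le> indicator {y..x} t *\<^sub>R ((g t)\<^sup>2 / (2 * t) - 2 * c * g t + c\<^sup>2 * (2 * t))"
        using \<open>0 < y\<close> by (auto split: split_indicator)
    qed
    then have "0 \<le> (x\<^sup>2 - y\<^sup>2) * ((G x - G y) - 2 * c * (U x - U y) + c\<^sup>2 * (x\<^sup>2 - y\<^sup>2))"
      using pos eq by simp
    also have "\<dots> = (x\<^sup>2 - y\<^sup>2) * (G x - G y) - (U x - U y)\<^sup>2"
    proof -
      have "c * (x\<^sup>2 - y\<^sup>2) = U x - U y" using pos by (simp add: c_def)
      moreover have "(x\<^sup>2 - y\<^sup>2) * ((G x - G y) - 2 * c * (U x - U y) + c\<^sup>2 * (x\<^sup>2 - y\<^sup>2)) =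
          (x\<^sup>2 - y\<^sup>2) * (G x - G y) - 2 * (c * (x\<^sup>2 - y\<^sup>2)) * (U x - U y) + (c * (x\<^sup>2 - y\<^sup>2))\<^sup>2"
        by algebra
      ultimately show ?thesis by (simp add: power2_eq_square)
    qed
    finally show ?thesis by simp
  qed
  consider "y < x" | "x < y" | "x = y" by linarith
  then show ?thesis
  proof cases
    case 2
    have "(U x - U y)\<^sup>2 = (U y - U x)\<^sup>2" by (rule power2_commute)
    also have "\<dots> \<le> (y\<^sup>2 - x\<^sup>2) * (G y - G x)" using 2 assms by (intro ordered)
    also have "\<dots> = (x\<^sup>2 - y\<^sup>2) * (G x - G y)" by algebra
    finally show ?thesis .
  qed (use assms ordered in auto)
qed

text \<open>On \<open>{a..b}\<close> with \<open>0 < a\<close> the weight is continuous and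
  positive, so dividing by \<open>2 * t * gauss_weight \<alpha> t\<close> preserves
  integrability.\<close>

lemma weighted_square_locally_integrable:
  assumes g: "set_integrable lborel {0<..} (\<lambda>t. (g t)\<^sup>2 * gauss_weight \<alpha> t)"
  shows "locally_integrable_Ioi (\<lambda>t. (g t)\<^sup>2 / (2 * t))"
  unfolding locally_integrable_Ioi_def
proof (intro allI impI)
  fix a b :: real assume "0 < a"
  have "set_integrable lborel {a..b} (\<lambda>t. ((g t)\<^sup>2 * gauss_weight \<alpha> t) * (1 / (2 * t * gauss_weight \<alpha> t)))"
  proof (rule set_integrable_mult_continuous)
    show "set_integrable lborel {a..b} (\<lambda>t. (g t)\<^sup>2 * gauss_weight \<alpha> t)"
      using \<open>0 < a\<close> by (intro set_integrable_subset[OF g]) auto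
    show "continuous_on {a..b} (\<lambda>t. 1 / (2 * t * gauss_weight \<alpha> t))"
      using \<open>0 < a\<close> gauss_weight_pos[of _ \<alpha>]
      by (intro continuous_intros continuous_on_subset[OF continuous_on_gauss_weight])
        (force simp: less_le)+
  qed
  moreover have "((g t)\<^sup>2 * gauss_weight \<alpha> t) * (1 / (2 * t * gauss_weight \<alpha> t)) = (g t)\<^sup>2 / (2 * t)"
    if "t \<in> {a..b}" for t
    using \<open>0 < a\<close> that gauss_weight_pos[of t \<alpha>] by simp
  ultimately show "set_integrable lborel {a..b} (\<lambda>t. (g t)\<^sup>2 / (2 * t))"
    by (subst set_integrable_cong[OF refl refl]) auto
qed

text \<open>Pairs \<open>(x, t)\<close> in which \<open>t\<close> lies between \<open>r\<close> and
  \<open>x\<close>, so that \<open>x\<close> is beyond \<open>t\<close> as seen from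
  \<open>r\<close>. At \<open>t = r\<close> both alternatives hold and the section in
  \<open>x\<close> is two-sided; this single value of \<open>t\<close> is discarded as a null
  set.\<close>

definition beyond :: "real \<Rightarrow> (real \<times> real) set" where
  "beyond r = {p. 0 < fst p \<and> 0 < snd p \<and>
    (r \<le> snd p \<and> snd p < fst p \<or> fst p < snd p \<and> snd p \<le> r)}"

lemma measurable_beyond [measurable]: "beyond r \<in> sets (borel \<Otimes>\<^sub>M borel)"
proof -
  have "{p \<in> space (borel \<Otimes>\<^sub>M borel). 0 < fst p \<and> 0 < snd p \<and>
      (r \<le> snd p \<and> snd p < fst p \<or> fst p < snd p \<and> snd p \<le> r)} \<in> sets (borel \<Otimes>\<^sub>M borel)"
    by measurable
  then show ?thesis by (simp add: beyond_def space_pair_measure)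
qed

lemma nn_integral_beyond_fst:
  assumes "0 < \<alpha>" "0 < t" "t \<noteq> sqrt \<alpha>"
  shows "(\<integral>\<^sup>+ x. ennreal (\<bar>x\<^sup>2 - \<alpha>\<bar> * gauss_weight \<alpha> x) * indicator (beyond (sqrt \<alpha>)) (x, t) \<partial>lborel) =
    ennreal (t * gauss_weight \<alpha> t)"
proof (cases "sqrt \<alpha> < t")
  case True
  have pos: "\<alpha> \<le> x\<^sup>2" if "t < x" for x
    using True that assms(1) by (intro sqrt_le_D) linarith
  have int: "integrable lborel (\<lambda>x. indicator {t<..} x *\<^sub>R ((x\<^sup>2 - \<alpha>) * gauss_weight \<alpha> x))"
  proof -
    have "set_integrable lborel {t<..} (\<lambda>x. (\<alpha> - x\<^sup>2) * gauss_weight \<alpha> x)"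
      using assms(2) by (intro gauss_weight_centered_integrable[OF assms(1)]) auto
    then have int': "integrable lborel (\<lambda>x. - (indicator {t<..} x *\<^sub>R ((\<alpha> - x\<^sup>2) * gauss_weight \<alpha> x)))"
      unfolding set_integrable_def by (rule Bochner_Integration.integrable_minus)
    have eq: "- (indicator {t<..} x *\<^sub>R ((\<alpha> - x\<^sup>2) * gauss_weight \<alpha> x)) =
        indicator {t<..} x *\<^sub>R ((x\<^sup>2 - \<alpha>) * gauss_weight \<alpha> x)" for x
      by (simp add: algebra_simps)
    show ?thesis using int' unfolding eq .
  qed
  have "(\<integral>\<^sup>+ x. ennreal (\<bar>x\<^sup>2 - \<alpha>\<bar> * gauss_weight \<alpha> x) * indicator (beyond (sqrt \<alpha>)) (x, t) \<partial>lborel) =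
      (\<integral>\<^sup>+ x. ennreal (indicator {t<..} x *\<^sub>R ((x\<^sup>2 - \<alpha>) * gauss_weight \<alpha> x)) \<partial>lborel)"
    using True assms pos by (intro nn_integral_cong) (auto simp: beyond_def split: split_indicator)
  also have "\<dots> = ennreal (LINT x:{t<..}|lborel. (x\<^sup>2 - \<alpha>) * gauss_weight \<alpha> x)"
    unfolding set_lebesgue_integral_def
    using pos by (intro nn_integral_eq_integral[OF int] AE_I2)
      (auto simp: gauss_weight_nonneg split: split_indicator)
  finally show ?thesis using gauss_weight_centered_above[OF assms(1,2)] by simp
next
  case False
  have pos: "x\<^sup>2 \<le> \<alpha>" if "x < t" "0 < x" for x
    using False that assms(1) by (intro sqrt_ge_absD) auto
  have int: "integrable lborel (\<lambda>x. indicator {0<..<t} x *\<^sub>R ((\<alpha> - x\<^sup>2) * gauss_weight \<alpha> x))"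
    unfolding set_integrable_def[symmetric]
    by (intro gauss_weight_centered_integrable[OF assms(1)]) auto
  have "(\<integral>\<^sup>+ x. ennreal (\<bar>x\<^sup>2 - \<alpha>\<bar> * gauss_weight \<alpha> x) * indicator (beyond (sqrt \<alpha>)) (x, t) \<partial>lborel) =
      (\<integral>\<^sup>+ x. ennreal (indicator {0<..<t} x *\<^sub>R ((\<alpha> - x\<^sup>2) * gauss_weight \<alpha> x)) \<partial>lborel)"
    using False assms pos by (intro nn_integral_cong) (auto simp: beyond_def split: split_indicator)
  also have "\<dots> = ennreal (LINT x:{0<..<t}|lborel. (\<alpha> - x\<^sup>2) * gauss_weight \<alpha> x)"
    unfolding set_lebesgue_integral_def
    using pos by (intro nn_integral_eq_integral[OF int] AE_I2)
      (auto simp: gauss_weight_nonneg split: split_indicator)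
  finally show ?thesis using gauss_weight_centered_below[OF assms(1,2)] by simp
qed

text \<open>The section in \<open>t\<close> is the interval between \<open>sqrt \<alpha>\<close> and
  \<open>x\<close> up to the endpoint \<open>x\<close>. As \<open>G\<close> is nondecreasing, its
  increment has the sign of \<open>x^2 - \<alpha>\<close>, which absorbs the absolute value.\<close>

lemma nn_integral_beyond_snd:
  assumes G: "primitive_Ioi G h" and h: "\<And>t. 0 < t \<Longrightarrow> 0 \<le> h t" and "0 < \<alpha>" "0 < x"
  shows "ennreal (\<bar>x\<^sup>2 - \<alpha>\<bar> * gauss_weight \<alpha> x) *
      (\<integral>\<^sup>+ t. ennreal (h t) * indicator (beyond (sqrt \<alpha>)) (x, t) \<partial>lborel) =
    ennreal ((x\<^sup>2 - \<alpha>) * (G x - G (sqrt \<alpha>)) * gauss_weight \<alpha> x)"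
proof -
  have Icc: "(\<integral>\<^sup>+ t. ennreal (h t) * indicator {a..b} t \<partial>lborel) = ennreal (G b - G a)"
    and mono: "G a \<le> G b" if "0 < a" "a \<le> b" for a b
  proof -
    have int: "integrable lborel (\<lambda>t. indicator {a..b} t *\<^sub>R h t)"
      using locally_integrable_IoiD[OF primitive_IoiD(1)[OF G] that(1), of b]
      by (simp add: set_integrable_def)
    have nn: "0 \<le> indicator {a..b} t *\<^sub>R h t" for t
      using h that by (auto split: split_indicator)
    have LINT: "G b - G a = (LINT t|lborel. indicator {a..b} t *\<^sub>R h t)"
      using primitive_IoiD(2)[OF G that] by (simp add: set_lebesgue_integral_def)
    have "(\<integral>\<^sup>+ t. ennreal (h t) * indicator {a..b} t \<partial>lborel) =
        (\<integral>\<^sup>+ t. ennreal (indicator {a..b} t *\<^sub>R h t) \<partial>lborel)"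
      by (intro nn_integral_cong) (auto split: split_indicator)
    also have "\<dots> = ennreal (G b - G a)"
      unfolding LINT using nn by (intro nn_integral_eq_integral[OF int] AE_I2)
    finally show "(\<integral>\<^sup>+ t. ennreal (h t) * indicator {a..b} t \<partial>lborel) = ennreal (G b - G a)" .
    have "0 \<le> G b - G a" unfolding LINT using nn by (intro integral_nonneg_AE AE_I2)
    then show "G a \<le> G b" by simp
  qed
  consider "sqrt \<alpha> < x" | "x < sqrt \<alpha>" | "x = sqrt \<alpha>" by linarith
  then show ?thesis
  proof cases
    case 1
    then have le: "\<alpha> \<le> x\<^sup>2" using assms by (simp add: real_sqrt_le_iff sqrt_le_D)
    have "(\<integral>\<^sup>+ t. ennreal (h t) * indicator (beyond (sqrt \<alpha>)) (x, t) \<partial>lborel) =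
        (\<integral>\<^sup>+ t. ennreal (h t) * indicator {sqrt \<alpha>..x} t \<partial>lborel)"
      using AE_lborel_singleton[of x]
    proof (intro nn_integral_cong_AE, eventually_elim)
      fix t assume "t \<noteq> x"
      moreover have "0 < t" if "sqrt \<alpha> \<le> t" using that assms(3) by (meson less_le_trans real_sqrt_gt_zero)
      ultimately show "ennreal (h t) * indicator (beyond (sqrt \<alpha>)) (x, t) = ennreal (h t) * indicator {sqrt \<alpha>..x} t"
        using 1 assms by (auto simp: beyond_def split: split_indicator)
    qed
    then show ?thesis
      using 1 le assms Icc[of "sqrt \<alpha>" x] mono[of "sqrt \<alpha>" x]
      by (simp add: ennreal_mult[symmetric] gauss_weight_nonneg mult_ac)
  next
    case 2
    then have le: "x\<^sup>2 \<le> \<alpha>" using assms by (intro sqrt_ge_absD) auto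
    have "(\<integral>\<^sup>+ t. ennreal (h t) * indicator (beyond (sqrt \<alpha>)) (x, t) \<partial>lborel) =
        (\<integral>\<^sup>+ t. ennreal (h t) * indicator {x..sqrt \<alpha>} t \<partial>lborel)"
      using AE_lborel_singleton[of x]
    proof (intro nn_integral_cong_AE, eventually_elim)
      fix t assume "t \<noteq> x"
      then show "ennreal (h t) * indicator (beyond (sqrt \<alpha>)) (x, t) = ennreal (h t) * indicator {x..sqrt \<alpha>} t"
        using 2 assms by (auto simp: beyond_def split: split_indicator)
    qed
    moreover have "(x\<^sup>2 - \<alpha>) * (G x - G (sqrt \<alpha>)) = (\<alpha> - x\<^sup>2) * (G (sqrt \<alpha>) - G x)" by algebra
    ultimately show ?thesis
      using 2 le assms Icc[of x "sqrt \<alpha>"] mono[of x "sqrt \<alpha>"]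
      by (simp add: ennreal_mult[symmetric] gauss_weight_nonneg mult_ac)
  qed (use assms in auto)
qed

text \<open>Tonelli for the nonnegative kernel \<open>K\<close>. The factor 1/2 is what remains of
  \<open>1 / (2 * t)\<close> after multiplication by the tail
  \<open>t * gauss_weight \<alpha> t\<close>. The finite energy on the right is what makes
  \<open>D\<close> integrable.\<close>

lemma weighted_energy_identity:
  assumes "0 < \<alpha>" and [measurable]: "g \<in> borel_measurable borel"
    and g: "set_integrable lborel {0<..} (\<lambda>t. (g t)\<^sup>2 * gauss_weight \<alpha> t)"
    and U: "primitive_Ioi U g" and G: "primitive_Ioi G (\<lambda>t. (g t)\<^sup>2 / (2 * t))"
  defines "D \<equiv> \<lambda>x. (x\<^sup>2 - \<alpha>) * (G x - G (sqrt \<alpha>)) * gauss_weight \<alpha> x"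
  shows "set_integrable lborel {0<..} D"
    and "(LINT x:{0<..}|lborel. D x) = (LINT t:{0<..}|lborel. (g t)\<^sup>2 * gauss_weight \<alpha> t) / 2"
proof -
  define h where "h t = (g t)\<^sup>2 / (2 * t)" for t
  define K where "K x t = ennreal (\<bar>x\<^sup>2 - \<alpha>\<bar> * gauss_weight \<alpha> x) *
    (ennreal (h t) * indicator (beyond (sqrt \<alpha>)) (x, t))" for x t
  have h_meas [measurable]: "h \<in> borel_measurable borel" unfolding h_def[abs_def] by measurable
  have h_nonneg: "0 \<le> h t" if "0 < t" for t using that by (simp add: h_def)
  have [measurable]: "case_prod K \<in> borel_measurable (lborel \<Otimes>\<^sub>M lborel)"
    unfolding K_def[abs_def] by measurable
  have G': "primitive_Ioi G h" using G by (simp add: h_def[abs_def])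
  have G_meas [measurable]: "(\<lambda>x. indicator {0<..} x *\<^sub>R D x) \<in> borel_measurable borel"
    unfolding D_def
    by (intro borel_measurable_continuous_on_indicator continuous_intros
        primitive_Ioi_continuous_on[OF G] continuous_on_gauss_weight) auto
  have inner_t: "(\<integral>\<^sup>+ t. K x t \<partial>lborel) = ennreal (indicator {0<..} x *\<^sub>R D x)" for x
  proof (cases "0 < x")
    case True
    then show ?thesis
      using nn_integral_beyond_snd[OF G' h_nonneg assms(1) True]
      by (simp add: K_def nn_integral_cmult D_def)
  qed (simp add: K_def beyond_def)
  have inner_x: "(\<integral>\<^sup>+ x. K x t \<partial>lborel) =
      ennreal (indicator {0<..} t *\<^sub>R ((g t)\<^sup>2 * gauss_weight \<alpha> t) / 2)" if "t \<noteq> sqrt \<alpha>" for t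
  proof (cases "0 < t")
    case True
    have "(\<integral>\<^sup>+ x. K x t \<partial>lborel) = (\<integral>\<^sup>+ x. ennreal (h t) *
        (ennreal (\<bar>x\<^sup>2 - \<alpha>\<bar> * gauss_weight \<alpha> x) * indicator (beyond (sqrt \<alpha>)) (x, t)) \<partial>lborel)"
      by (intro nn_integral_cong) (simp add: K_def mult_ac)
    also have "\<dots> = ennreal (h t) * ennreal (t * gauss_weight \<alpha> t)"
      using nn_integral_beyond_fst[OF assms(1) True that] by (subst nn_integral_cmult) auto
    also have "\<dots> = ennreal (h t * (t * gauss_weight \<alpha> t))"
      using h_nonneg[OF True] True by (simp add: ennreal_mult[symmetric] gauss_weight_nonneg)
    finally show ?thesis using True by (simp add: h_def)
  qed (simp add: K_def beyond_def)
  have "(\<integral>\<^sup>+ x. ennreal (indicator {0<..} x *\<^sub>R D x) \<partial>lborel) = (\<integral>\<^sup>+ x. (\<integral>\<^sup>+ t. K x t \<partial>lborel) \<partial>lborel)"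
    by (simp only: inner_t)
  also have "\<dots> = (\<integral>\<^sup>+ t. (\<integral>\<^sup>+ x. K x t \<partial>lborel) \<partial>lborel)"
    by (rule lborel_pair.Fubini'[symmetric]) measurable
  also have "\<dots> = (\<integral>\<^sup>+ t. ennreal (indicator {0<..} t *\<^sub>R ((g t)\<^sup>2 * gauss_weight \<alpha> t) / 2) \<partial>lborel)"
    by (rule nn_integral_cong_AE, use AE_lborel_singleton[of "sqrt \<alpha>"] in eventually_elim)
      (erule inner_x)
  also have "\<dots> = ennreal (LINT t|lborel. indicator {0<..} t *\<^sub>R ((g t)\<^sup>2 * gauss_weight \<alpha> t) / 2)"
    using g by (intro nn_integral_eq_integral AE_I2)
      (auto simp: set_integrable_def gauss_weight_nonneg)
  also have "\<dots> = ennreal ((LINT t:{0<..}|lborel. (g t)\<^sup>2 * gauss_weight \<alpha> t) / 2)"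
    by (simp add: set_lebesgue_integral_def)
  finally have total: "(\<integral>\<^sup>+ x. ennreal (indicator {0<..} x *\<^sub>R D x) \<partial>lborel) =
    ennreal ((LINT t:{0<..}|lborel. (g t)\<^sup>2 * gauss_weight \<alpha> t) / 2)" .
  \<comment> \<open>The product is nonnegative because Cauchy--Schwarz bounds a square by
    it.\<close>
  have "0 \<le> (x\<^sup>2 - \<alpha>) * (G x - G (sqrt \<alpha>))" if "0 < x" for x
    using order_trans[OF zero_le_power2 primitive_Ioi_cauchy_schwarz[OF U G that, of "sqrt \<alpha>"]] assms(1)
    by simp
  then have nonneg: "0 \<le> indicator {0<..} x *\<^sub>R D x" for x
    by (simp add: D_def gauss_weight_nonneg split: split_indicator)
  have "0 \<le> (LINT t:{0<..}|lborel. (g t)\<^sup>2 * gauss_weight \<alpha> t) / 2"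
    unfolding set_lebesgue_integral_def
    by (intro divide_nonneg_pos integral_nonneg_AE AE_I2) (auto simp: gauss_weight_nonneg)
  then have "integrable lborel (\<lambda>x. indicator {0<..} x *\<^sub>R D x) \<and>
    (LINT x|lborel. indicator {0<..} x *\<^sub>R D x) = (LINT t:{0<..}|lborel. (g t)\<^sup>2 * gauss_weight \<alpha> t) / 2"
    using nonneg
    by (intro nn_integral_eq_integrable[THEN iffD1, OF _ _ _ total]) (use G_meas in auto)
  then show "set_integrable lborel {0<..} D"
    and "(LINT x:{0<..}|lborel. D x) = (LINT t:{0<..}|lborel. (g t)\<^sup>2 * gauss_weight \<alpha> t) / 2"
    by (simp_all add: set_integrable_def set_lebesgue_integral_def)
qed

subsection \<open>The weighted Poincare inequality and its equality case\<close>

lemma continuous_AE_eq_0_Ioi: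
  fixes f :: "real \<Rightarrow> real"
  assumes "continuous_on {0<..} f" "AE x in lborel. 0 < x \<longrightarrow> f x = 0" "0 < x"
  shows "f x = 0"
proof (rule ccontr)
  assume "f x \<noteq> 0"
  define S where "S = {0<..} \<inter> f -` (- {0})"
  have "open S"
    unfolding S_def using assms(1) by (intro continuous_open_preimage) auto
  moreover have "x \<in> S" using assms(3) \<open>f x \<noteq> 0\<close> by (simp add: S_def)
  ultimately have "\<not> negligible S" by (intro open_not_negligible) auto
  moreover have "AE y in lborel. y \<notin> S"
    using assms(2) by eventually_elim (auto simp: S_def)
  then have "S \<in> null_sets lborel"
    using \<open>open S\<close> by (subst AE_iff_null_sets) auto
  ultimately show False
    by (simp add: negligible_iff_null_sets null_sets_completionI)
qed

lemma primitive_square_le_energy_density: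
  assumes "0 < \<alpha>" "0 < x"
    and U: "primitive_Ioi U g" and G: "primitive_Ioi G (\<lambda>t. (g t)\<^sup>2 / (2 * t))"
  shows "(U x - U (sqrt \<alpha>))\<^sup>2 * gauss_weight \<alpha> x \<le> (x\<^sup>2 - \<alpha>) * (G x - G (sqrt \<alpha>)) * gauss_weight \<alpha> x"
  using primitive_Ioi_cauchy_schwarz[OF U G assms(2), of "sqrt \<alpha>"] assms(1)
  by (intro mult_right_mono) (auto simp: gauss_weight_nonneg)

lemma weighted_poincare_primitive:
  assumes "0 < \<alpha>" and [measurable]: "g \<in> borel_measurable borel" and U: "primitive_Ioi U g"
    and g: "set_integrable lborel {0<..} (\<lambda>t. (g t)\<^sup>2 * gauss_weight \<alpha> t)"
  shows "set_integrable lborel {0<..} (\<lambda>x. (U x - U (sqrt \<alpha>))\<^sup>2 * gauss_weight \<alpha> x)"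
    and "2 * (LINT x:{0<..}|lborel. (U x - U (sqrt \<alpha>))\<^sup>2 * gauss_weight \<alpha> x) \<le>
      (LINT t:{0<..}|lborel. (g t)\<^sup>2 * gauss_weight \<alpha> t)"
proof -
  obtain G where G: "primitive_Ioi G (\<lambda>t. (g t)\<^sup>2 / (2 * t))"
    using primitive_Ioi_exists[OF weighted_square_locally_integrable[OF g]] .
  note energy = weighted_energy_identity[OF assms(1,2) g U G]
  note le = primitive_square_le_energy_density[OF assms(1) _ U G]
  show int: "set_integrable lborel {0<..} (\<lambda>x. (U x - U (sqrt \<alpha>))\<^sup>2 * gauss_weight \<alpha> x)"
  proof (rule set_integrable_bound[OF energy(1)])
    show "set_borel_measurable lborel {0<..} (\<lambda>x. (U x - U (sqrt \<alpha>))\<^sup>2 * gauss_weight \<alpha> x)"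
      unfolding set_borel_measurable_def measurable_lborel2
      by (intro borel_measurable_continuous_on_indicator continuous_intros
          primitive_Ioi_continuous_on[OF U] continuous_on_gauss_weight) auto
    show "AE x in lborel. x \<in> {0<..} \<longrightarrow> norm ((U x - U (sqrt \<alpha>))\<^sup>2 * gauss_weight \<alpha> x) \<le>
        norm ((x\<^sup>2 - \<alpha>) * (G x - G (sqrt \<alpha>)) * gauss_weight \<alpha> x)"
      using le by (intro AE_I2) (auto simp: gauss_weight_nonneg intro: order_trans[OF _ abs_ge_self])
  qed
  have "(LINT x:{0<..}|lborel. (U x - U (sqrt \<alpha>))\<^sup>2 * gauss_weight \<alpha> x) \<le>
      (LINT x:{0<..}|lborel. (x\<^sup>2 - \<alpha>) * (G x - G (sqrt \<alpha>)) * gauss_weight \<alpha> x)"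
    using le by (intro set_integral_mono int energy(1)) auto
  then show "2 * (LINT x:{0<..}|lborel. (U x - U (sqrt \<alpha>))\<^sup>2 * gauss_weight \<alpha> x) \<le>
      (LINT t:{0<..}|lborel. (g t)\<^sup>2 * gauss_weight \<alpha> t)"
    using energy(2) by simp
qed

text \<open>The condition \<open>mean\<close> cannot be dispensed with: a continuous function with
  different slopes in \<open>x^2\<close> on the two sides of \<open>sqrt \<alpha>\<close> also
  satisfies \<open>eq\<close>.\<close>

lemma weighted_poincare_primitive_equality:
  assumes "0 < \<alpha>" and [measurable]: "g \<in> borel_measurable borel" and U: "primitive_Ioi U g"
    and g: "set_integrable lborel {0<..} (\<lambda>t. (g t)\<^sup>2 * gauss_weight \<alpha> t)"
    and eq: "2 * (LINT x:{0<..}|lborel. (U x - U (sqrt \<alpha>))\<^sup>2 * gauss_weight \<alpha> x) =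
      (LINT t:{0<..}|lborel. (g t)\<^sup>2 * gauss_weight \<alpha> t)"
    and mean: "(LINT x:{0<..}|lborel. (U x - U (sqrt \<alpha>)) * gauss_weight \<alpha> x) = 0"
  obtains c where "\<And>x. 0 < x \<Longrightarrow> U x = U (sqrt \<alpha>) + c * (x\<^sup>2 - \<alpha>)"
proof -
  define r where "r = sqrt \<alpha>"
  have r: "0 < r" "r\<^sup>2 = \<alpha>" using assms(1) by (auto simp: r_def)
  obtain G where G: "primitive_Ioi G (\<lambda>t. (g t)\<^sup>2 / (2 * t))"
    using primitive_Ioi_exists[OF weighted_square_locally_integrable[OF g]] .
  note energy = weighted_energy_identity[OF assms(1,2) g U G]
  note int = weighted_poincare_primitive(1)[OF assms(1,2) U g]
  define v where "v x = U x - U r" for x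
  define p where "p x = x\<^sup>2 - \<alpha>" for x :: real
  define \<gamma> where "\<gamma> x = G x - G r" for x
  have "AE x in lborel. indicator {0<..} x *\<^sub>R ((U x - U (sqrt \<alpha>))\<^sup>2 * gauss_weight \<alpha> x) =
      indicator {0<..} x *\<^sub>R ((x\<^sup>2 - \<alpha>) * (G x - G (sqrt \<alpha>)) * gauss_weight \<alpha> x)"
  proof (rule sigma_finite_measure.integral_eq_mono_AE_eq_AE[OF sigma_finite_lborel])
    show "(LINT x|lborel. indicator {0<..} x *\<^sub>R ((U x - U (sqrt \<alpha>))\<^sup>2 * gauss_weight \<alpha> x)) =
        (LINT x|lborel. indicator {0<..} x *\<^sub>R ((x\<^sup>2 - \<alpha>) * (G x - G (sqrt \<alpha>)) * gauss_weight \<alpha> x))"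
      using eq energy(2) by (simp add: set_lebesgue_integral_def)
    show "AE x in lborel. indicator {0<..} x *\<^sub>R ((U x - U (sqrt \<alpha>))\<^sup>2 * gauss_weight \<alpha> x) \<le>
        indicator {0<..} x *\<^sub>R ((x\<^sup>2 - \<alpha>) * (G x - G (sqrt \<alpha>)) * gauss_weight \<alpha> x)"
      using primitive_square_le_energy_density[OF assms(1) _ U G]
      by (intro AE_I2) (auto split: split_indicator)
  qed (use int energy(1) in \<open>simp_all add: set_integrable_def\<close>)
  then have "AE x in lborel. 0 < x \<longrightarrow> (v x)\<^sup>2 - p x * \<gamma> x = 0"
  proof (eventually_elim, intro impI)
    fix x :: real assume "0 < x"
      "indicator {0<..} x *\<^sub>R ((U x - U (sqrt \<alpha>))\<^sup>2 * gauss_weight \<alpha> x) =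
        indicator {0<..} x *\<^sub>R ((x\<^sup>2 - \<alpha>) * (G x - G (sqrt \<alpha>)) * gauss_weight \<alpha> x)"
    then show "(v x)\<^sup>2 - p x * \<gamma> x = 0"
      using gauss_weight_pos[of x \<alpha>] by (simp add: v_def p_def \<gamma>_def r_def)
  qed
  \<comment> \<open>Equal integrals give the identity only almost everywhere; continuity extends it
    to every point, including the sample points used below.\<close>
  moreover have "continuous_on {0<..} (\<lambda>x. (v x)\<^sup>2 - p x * \<gamma> x)"
    unfolding v_def p_def \<gamma>_def
    by (intro continuous_intros primitive_Ioi_continuous_on[OF U] primitive_Ioi_continuous_on[OF G])
  ultimately have v_sq: "(v x)\<^sup>2 = p x * \<gamma> x" if "0 < x" for x
    using continuous_AE_eq_0_Ioi[of "\<lambda>x. (v x)\<^sup>2 - p x * \<gamma> x" x] that by simp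
  text \<open>Equality in the Cauchy--Schwarz inequality on \<open>[r, x]\<close> and \<open>[r, y]\<close> forces equal slopes in
    the variable \<open>x\<^sup>2\<close>, as long as \<open>x\<close> and \<open>y\<close> lie on the same side of \<open>r\<close>.\<close>
  have slope: "p x * v y = p y * v x" if "0 < x" "0 < y" "0 < p x * p y" for x y
  proof -
    have "(v x - v y)\<^sup>2 \<le> (p x - p y) * (\<gamma> x - \<gamma> y)"
      using primitive_Ioi_cauchy_schwarz[OF U G that(1,2)] by (simp add: v_def p_def \<gamma>_def)
    \<comment> \<open>After multiplication by the positive \<open>p x * p y\<close>, substituting
      \<open>v_sq\<close> removes \<open>\<gamma>\<close> and leaves minus a perfect square, which
      must then be 0.\<close>
    then have "0 \<le> (p x * p y) * ((p x - p y) * (\<gamma> x - \<gamma> y) - (v x - v y)\<^sup>2)"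
      using that(3) by simp
    also have "\<dots> = - ((p x * v y - p y * v x)\<^sup>2)"
      using v_sq[OF that(1)] v_sq[OF that(2)] by algebra
    finally show ?thesis by simp
  qed
  \<comment> \<open>Any one point on each side of \<open>r\<close> determines the slope there;
    \<open>2 * r\<close> and \<open>r / 2\<close> are convenient choices.\<close>
  define c1 where "c1 = v (2 * r) / p (2 * r)"
  define c2 where "c2 = v (r / 2) / p (r / 2)"
  have p: "0 < p (2 * r)" "p (r / 2) < 0"
    using assms(1) by (auto simp: p_def power_mult_distrib power_divide r(2))
  have above: "v x = c1 * p x" if "r < x" for x
  proof -
    have "0 < p x" using that r by (simp add: p_def flip: r(2)) (simp add: power_strict_mono)
    then show ?thesis using slope[of x "2 * r"] p(1) that r by (simp add: c1_def field_simps)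
  qed
  have below: "v x = c2 * p x" if "0 < x" "x < r" for x
  proof -
    have "p x < 0" using that r by (simp add: p_def flip: r(2)) (simp add: power_strict_mono)
    then show ?thesis
      using slope[of x "r / 2"] p(2) that r by (simp add: c2_def field_simps mult_neg_neg)
  qed
  have at: "v r = 0" "p r = 0" using r by (auto simp: v_def p_def)
  \<comment> \<open>The mean splits into the two one-sided integrals at \<open>r\<close>. Both equal
    \<open>r * gauss_weight \<alpha> r > 0\<close>, so mean 0 forces \<open>c1 = c2\<close>.\<close>
  have "v x * gauss_weight \<alpha> x = c1 * (indicator {r<..} x *\<^sub>R ((x\<^sup>2 - \<alpha>) * gauss_weight \<alpha> x)) -
      c2 * (indicator {0<..<r} x *\<^sub>R ((\<alpha> - x\<^sup>2) * gauss_weight \<alpha> x))" if "0 < x" for x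
    using above[of x] below[of x] at that by (cases x r rule: linorder_cases) (simp_all add: p_def, simp_all add: left_diff_distrib right_diff_distrib)
  then have "indicator {0<..} x *\<^sub>R (v x * gauss_weight \<alpha> x) =
      c1 * (indicator {r<..} x *\<^sub>R ((x\<^sup>2 - \<alpha>) * gauss_weight \<alpha> x)) -
      c2 * (indicator {0<..<r} x *\<^sub>R ((\<alpha> - x\<^sup>2) * gauss_weight \<alpha> x))" for x
    using r(1) by (auto split: split_indicator)
  then have "(LINT x:{0<..}|lborel. v x * gauss_weight \<alpha> x) =
      (LINT x|lborel. c1 * (indicator {r<..} x *\<^sub>R ((x\<^sup>2 - \<alpha>) * gauss_weight \<alpha> x)) -
        c2 * (indicator {0<..<r} x *\<^sub>R ((\<alpha> - x\<^sup>2) * gauss_weight \<alpha> x)))"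
    by (simp only: set_lebesgue_integral_def)
  also have "\<dots> = c1 * (LINT x:{r<..}|lborel. (x\<^sup>2 - \<alpha>) * gauss_weight \<alpha> x) -
      c2 * (LINT x:{0<..<r}|lborel. (\<alpha> - x\<^sup>2) * gauss_weight \<alpha> x)"
  proof -
    have "set_integrable lborel {r<..} (\<lambda>x. - ((\<alpha> - x\<^sup>2) * gauss_weight \<alpha> x))"
      using r(1) gauss_weight_centered_integrable[OF assms(1), of "{r<..}"]
      by (simp add: set_integrable_def)
    then have "set_integrable lborel {r<..} (\<lambda>x. (x\<^sup>2 - \<alpha>) * gauss_weight \<alpha> x)"
      by (simp add: algebra_simps)
    moreover have "set_integrable lborel {0<..<r} (\<lambda>x. (\<alpha> - x\<^sup>2) * gauss_weight \<alpha> x)"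
      by (intro gauss_weight_centered_integrable[OF assms(1)]) auto
    ultimately show ?thesis
      by (simp add: set_integrable_def set_lebesgue_integral_def)
  qed
  also have "\<dots> = (c1 - c2) * (r * gauss_weight \<alpha> r)"
    unfolding gauss_weight_centered_above[OF assms(1) r(1)] gauss_weight_centered_below[OF assms(1) r(1)]
    by (simp add: left_diff_distrib)
  finally have "c1 = c2" using mean r(1) gauss_weight_pos[of r \<alpha>] by (simp add: v_def r_def)
  have "U x = U (sqrt \<alpha>) + c1 * (x\<^sup>2 - \<alpha>)" if "0 < x" for x
  proof -
    have "v x = c1 * p x"
      using above[of x] below[of x] at that \<open>c1 = c2\<close> by (cases x r rule: linorder_cases) auto
    then show ?thesis by (simp add: v_def p_def r_def)
  qed
  then show thesis by (rule that)
qed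

section \<open>The weighted square integral as a quadratic polynomial in the subtracted
  constant\<close>

lemma weighted_variance_expansion:
  assumes "0 < \<alpha>" and v: "set_integrable lborel {0<..} (\<lambda>x. (v x)\<^sup>2 * gauss_weight \<alpha> x)"
    and [measurable]: "v \<in> borel_measurable borel"
  shows "(LINT x:{0<..}|lborel. (v x - d)\<^sup>2 * gauss_weight \<alpha> x) =
    (LINT x:{0<..}|lborel. (v x)\<^sup>2 * gauss_weight \<alpha> x) -
    2 * d * (LINT x:{0<..}|lborel. v x * gauss_weight \<alpha> x) +
    d\<^sup>2 * (LINT x:{0<..}|lborel. gauss_weight \<alpha> x)"
proof -
  have lin: "set_integrable lborel {0<..} (\<lambda>x. v x * gauss_weight \<alpha> x)"
  proof (rule set_integrable_bound)
    show "set_integrable lborel {0<..} (\<lambda>x. (v x)\<^sup>2 * gauss_weight \<alpha> x + gauss_weight \<alpha> x)"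
      by (intro set_integral_add v gauss_weight_integrable assms(1))
    show "set_borel_measurable lborel {0<..} (\<lambda>x. v x * gauss_weight \<alpha> x)"
      unfolding set_borel_measurable_def by measurable
    \<comment> \<open>Since the weight has finite mass, this bound makes the linear term
      integrable.\<close>
    have "\<bar>y\<bar> \<le> y\<^sup>2 + 1" for y :: real
    proof -
      have "0 \<le> (\<bar>y\<bar> - 1)\<^sup>2" "0 \<le> \<bar>y\<bar>" by auto
      then show ?thesis by (simp add: power2_diff)
    qed
    then have "\<bar>v x\<bar> * gauss_weight \<alpha> x \<le> ((v x)\<^sup>2 + 1) * gauss_weight \<alpha> x" for x
      by (intro mult_right_mono gauss_weight_nonneg)
    then show "AE x in lborel. x \<in> {0<..} \<longrightarrow> norm (v x * gauss_weight \<alpha> x) \<le>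
        norm ((v x)\<^sup>2 * gauss_weight \<alpha> x + gauss_weight \<alpha> x)"
      by (intro AE_I2) (auto simp: abs_mult gauss_weight_nonneg distrib_right)
  qed
  have "(LINT x:{0<..}|lborel. (v x - d)\<^sup>2 * gauss_weight \<alpha> x) =
    (LINT x:{0<..}|lborel. (v x)\<^sup>2 * gauss_weight \<alpha> x - 2 * d * (v x * gauss_weight \<alpha> x) +
      d\<^sup>2 * gauss_weight \<alpha> x)"
    by (intro set_lebesgue_integral_cong) (auto simp: power2_eq_square algebra_simps)
  then show ?thesis
    using v lin gauss_weight_integrable[OF assms(1)]
    by (simp add: set_integral_add set_integral_diff)
qed

text \<open>Subtracting the mean \<open>M / Z\<close> would lower the integral by
  \<open>M^2 / Z\<close>, so minimality at \<open>d = 0\<close> leaves only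
  \<open>M = 0\<close>.\<close>

lemma weighted_mean_eq_0_if_minimal:
  assumes "0 < \<alpha>" and v: "set_integrable lborel {0<..} (\<lambda>x. (v x)\<^sup>2 * gauss_weight \<alpha> x)"
    and [measurable]: "v \<in> borel_measurable borel"
    and min: "\<And>d. (LINT x:{0<..}|lborel. (v x)\<^sup>2 * gauss_weight \<alpha> x) \<le>
      (LINT x:{0<..}|lborel. (v x - d)\<^sup>2 * gauss_weight \<alpha> x)"
  shows "(LINT x:{0<..}|lborel. v x * gauss_weight \<alpha> x) = 0"
proof -
  define Z where "Z = (LINT x:{0<..}|lborel. gauss_weight \<alpha> x)"
  define M where "M = (LINT x:{0<..}|lborel. v x * gauss_weight \<alpha> x)"
  have Z: "0 < Z" unfolding Z_def by (rule gauss_weight_mass_pos[OF assms(1)])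
  have "0 \<le> (M / Z)\<^sup>2 * Z - 2 * (M / Z) * M"
    using min[of "M / Z"] weighted_variance_expansion[OF assms(1-3), of "M / Z"]
    by (simp add: Z_def M_def)
  also have "\<dots> = - (M\<^sup>2 / Z)" using Z by (simp add: power2_eq_square field_simps)
  finally have "M\<^sup>2 \<le> 0" using Z by (simp add: divide_le_0_iff)
  then show ?thesis by (simp add: M_def)
qed

subsection \<open>Weak derivatives on the half-line\<close>

text \<open>Passage between the Lebesgue measure of the definitions and \<open>lborel\<close>, over
  which the analysis is carried out with Borel representatives.\<close>

lemma
  fixes f f\<^sub>0 :: "real \<Rightarrow> real"
  assumes A: "A \<in> sets borel" and f\<^sub>0: "set_borel_measurable borel A f\<^sub>0"
    and AE: "AE x in lborel. x \<in> A \<longrightarrow> f x = f\<^sub>0 x"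
  shows set_integrable_lebesgue_iff_lborel: "set_integrable lebesgue A f \<longleftrightarrow> set_integrable lborel A f\<^sub>0"
    and LINT_lebesgue_eq_lborel: "(LINT x:A|lebesgue. f x) = (LINT x:A|lborel. f\<^sub>0 x)"
proof -
  have borel: "(\<lambda>x. indicator A x *\<^sub>R f\<^sub>0 x) \<in> borel_measurable lborel"
    using f\<^sub>0 by (simp add: set_borel_measurable_def)
  then have leb: "(\<lambda>x. indicator A x *\<^sub>R f\<^sub>0 x) \<in> borel_measurable lebesgue"
    by (rule measurable_completion)
  have AE': "AE x in lebesgue. indicator A x *\<^sub>R f\<^sub>0 x = indicator A x *\<^sub>R f x"
    using AE_completion[OF AE] by eventually_elim (auto split: split_indicator)
  have leb': "(\<lambda>x. indicator A x *\<^sub>R f x) \<in> borel_measurable lebesgue"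
    using leb AE' by (rule borel_measurable_AE)
  show "set_integrable lebesgue A f \<longleftrightarrow> set_integrable lborel A f\<^sub>0"
    unfolding set_integrable_def
    using integrable_cong_AE[OF leb leb' AE'] integrable_completion[OF borel] by simp
  show "(LINT x:A|lebesgue. f x) = (LINT x:A|lborel. f\<^sub>0 x)"
    unfolding set_lebesgue_integral_def
    using integral_cong_AE[OF leb leb' AE'] integral_completion[OF borel] by simp
qed

text \<open>A nonempty compact subset of the half-line has a positive minimum and a maximum, so
  compact intervals with positive left end suffice.\<close>

lemma locally_integrable_on_Ioi_iff:
  assumes [measurable]: "f\<^sub>0 \<in> borel_measurable borel"
    and AE: "AE x in lborel. 0 < x \<longrightarrow> f x = f\<^sub>0 x"
  shows "locally_integrable_on {0<..} f \<longleftrightarrow> locally_integrable_Ioi f\<^sub>0"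
proof -
  have iff: "set_integrable lebesgue K f \<longleftrightarrow> set_integrable lborel K f\<^sub>0"
    if "compact K" "K \<subseteq> {0<..}" for K
  proof (rule set_integrable_lebesgue_iff_lborel)
    show "K \<in> sets borel" using that(1) by (simp add: compact_imp_closed)
    then show "set_borel_measurable borel K f\<^sub>0" unfolding set_borel_measurable_def by measurable
    show "AE x in lborel. x \<in> K \<longrightarrow> f x = f\<^sub>0 x"
      using AE by eventually_elim (use that(2) in auto)
  qed
  show ?thesis
  proof
    assume "locally_integrable_on {0<..} f"
    then show "locally_integrable_Ioi f\<^sub>0"
      unfolding locally_integrable_Ioi_def locally_integrable_on_def
      using iff by (metis atLeastAtMost_iff compact_Icc greaterThan_iff less_le_trans subsetI)
  next
    assume loc: "locally_integrable_Ioi f\<^sub>0"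
    show "locally_integrable_on {0<..} f"
      unfolding locally_integrable_on_def
    proof (intro allI impI, elim conjE)
      fix K :: "real set" assume K: "compact K" "K \<subseteq> {0<..}"
      show "set_integrable lebesgue K f"
      proof (cases "K = {}")
        case False
        obtain a where a: "a \<in> K" "\<And>x. x \<in> K \<Longrightarrow> a \<le> x"
          using compact_attains_inf[OF K(1) False] by blast
        obtain b where b: "\<And>x. x \<in> K \<Longrightarrow> x \<le> b"
          using compact_attains_sup[OF K(1) False] by blast
        have "set_integrable lborel {a..b} f\<^sub>0"
          using loc a(1) K(2) by (intro locally_integrable_IoiD) auto
        then have "set_integrable lborel K f\<^sub>0"
          by (rule set_integrable_subset) (use a b K(1) in \<open>auto simp: compact_imp_closed\<close>)
        then show ?thesis using iff[OF K] by simp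
      qed (simp add: set_integrable_def)
    qed
  qed
qed

text \<open>Local integrability makes the restrictions to \<open>{1 / Suc n..Suc n}\<close> Lebesgue
  measurable. So is their pointwise limit, the restriction to the half-line, and it agrees with a
  Borel function almost everywhere.\<close>

lemma locally_integrable_on_Ioi_borel_representative:
  assumes "locally_integrable_on {0<..} f"
  obtains f\<^sub>0 where "f\<^sub>0 \<in> borel_measurable borel" "AE x in lborel. 0 < x \<longrightarrow> f x = f\<^sub>0 x"
    "locally_integrable_Ioi f\<^sub>0"
proof -
  have "(\<lambda>x. indicator {1 / Suc n..Suc n} x *\<^sub>R f x) \<in> borel_measurable lebesgue" for n :: nat
  proof -
    have "set_integrable lebesgue {1 / Suc n..Suc n} f"
    proof -
      have "{1 / Suc n..Suc n} \<subseteq> {0<..}" by (auto intro: less_le_trans[of 0 "1 / Suc n"])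
      then show ?thesis using assms compact_Icc unfolding locally_integrable_on_def by blast
    qed
    then show ?thesis unfolding set_integrable_def by (rule borel_measurable_integrable)
  qed
  moreover have "(\<lambda>n. indicator {1 / Suc n..Suc n} x *\<^sub>R f x) \<longlonglongrightarrow> indicator {0<..} x *\<^sub>R f x" for x
  proof (cases "0 < x")
    case True
    obtain n1 n2 :: nat where n: "1 / x < n1" "x < n2" using reals_Archimedean2 by meson
    have "x \<in> {1 / Suc m..Suc m}" if "max n1 n2 \<le> m" for m
    proof -
      have "1 / x < Suc m" "x < Suc m" using n that by auto
      then show ?thesis using True by (auto simp: field_simps)
    qed
    then have "eventually (\<lambda>m. indicator {1 / Suc m..Suc m} x *\<^sub>R f x = indicator {0<..} x *\<^sub>R f x) sequentially"
      using True by (intro eventually_sequentiallyI[of "max n1 n2"]) (auto simp: indicator_def)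
    then show ?thesis by (rule tendsto_eventually)
  next
    case False
    have "x \<notin> {1 / Suc m..Suc m}" for m :: nat
    proof -
      have "0 < 1 / real (Suc m)" by simp
      then show ?thesis using False by (meson atLeastAtMost_iff less_le_trans)
    qed
    then show ?thesis using False by simp
  qed
  ultimately have "(\<lambda>x. indicator {0<..} x *\<^sub>R f x) \<in> borel_measurable lebesgue"
    by (rule borel_measurable_LIMSEQ_real[rotated])
  then obtain f\<^sub>0 where f\<^sub>0: "f\<^sub>0 \<in> borel_measurable lborel"
    "AE x in lborel. indicator {0<..} x *\<^sub>R f x = f\<^sub>0 x"
    by (auto dest: completion_ex_borel_measurable_real)
  show thesis
  proof (rule that)
    show "f\<^sub>0 \<in> borel_measurable borel" using f\<^sub>0(1) by simp
    show AE: "AE x in lborel. 0 < x \<longrightarrow> f x = f\<^sub>0 x"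
      using f\<^sub>0(2) by eventually_elim auto
    show "locally_integrable_Ioi f\<^sub>0"
      using assms locally_integrable_on_Ioi_iff[OF _ AE] f\<^sub>0(1) by simp
  qed
qed

lemma test_function_on_Ioi:
  assumes "0 < a" "smooth \<phi>" "\<And>x. x \<notin> {a<..<b} \<Longrightarrow> \<phi> x = 0"
  shows "test_function_on {0<..} \<phi>"
proof -
  have "{x. \<phi> x \<noteq> 0} \<subseteq> {a<..<b}" using assms(3) by blast
  then have "{x. \<phi> x \<noteq> 0} \<subseteq> {a..b}"
    by (rule order_trans) (rule greaterThanLessThan_subseteq_atLeastAtMost_iff[THEN iffD2], simp)
  then have sub: "closure {x. \<phi> x \<noteq> 0} \<subseteq> {a..b}" by (rule closure_minimal) simp
  then have "compact ({a..b} \<inter> closure {x. \<phi> x \<noteq> 0})"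
    by (intro compact_Int_closed) auto
  then have "compact (closure {x. \<phi> x \<noteq> 0})"
    using sub by (simp only: Int_absorb1)
  moreover have "{a..b} \<subseteq> {0<..}" using assms(1) by (auto intro: less_le_trans)
  then have "closure {x. \<phi> x \<noteq> 0} \<subseteq> {0<..}" using sub by (rule order_trans[rotated])
  ultimately show ?thesis
    using assms(2) by (simp only: test_function_on_def smooth_def) blast
qed

lemma test_function_on_Ioi_support:
  assumes "test_function_on {0<..} \<phi>"
  obtains a b where "0 < a" "a < b" "smooth \<phi>" "\<And>x. x \<notin> {a<..<b} \<Longrightarrow> \<phi> x = 0"
proof -
  define S where "S = closure {x. \<phi> x \<noteq> 0}"
  have S: "compact S" "S \<subseteq> {0<..}" and \<phi>: "smooth \<phi>"
    using assms by (auto simp: test_function_on_def smooth_def S_def)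
  have sub: "\<phi> x = 0" if "x \<notin> S" for x
    using that closure_subset[of "{x. \<phi> x \<noteq> 0}"] unfolding S_def by blast
  show thesis
  proof (cases "S = {}")
    case True
    then show ?thesis using sub \<phi> by (intro that[of 1 2]) auto
  next
    case False
    obtain a where a: "a \<in> S" "\<And>x. x \<in> S \<Longrightarrow> a \<le> x"
      using compact_attains_inf[OF S(1) False] by blast
    obtain b where b: "b \<in> S" "\<And>x. x \<in> S \<Longrightarrow> x \<le> b"
      using compact_attains_sup[OF S(1) False] by blast
    have "0 < a" using a(1) S(2) by auto
    \<comment> \<open>The margins turn the closed hull of the support into an open interval that
      still keeps away from 0.\<close>
    have "x \<in> {a / 2<..<b + 1}" if "x \<in> S" for x
      using a(2)[OF that] b(2)[OF that] \<open>0 < a\<close> by simp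
    then have "\<phi> x = 0" if "x \<notin> {a / 2<..<b + 1}" for x
      using that sub by blast
    moreover have "a / 2 < b + 1" using b(2)[OF a(1)] \<open>0 < a\<close> by simp
    ultimately show ?thesis using \<open>0 < a\<close> \<phi> by (intro that[of "a / 2" "b + 1"]) auto
  qed
qed

lemma LINT_Ioi_mult_lebesgue_eq_lborel:
  fixes f f\<^sub>0 \<psi> :: "real \<Rightarrow> real"
  assumes [measurable]: "f\<^sub>0 \<in> borel_measurable borel" and AE: "AE x in lborel. 0 < x \<longrightarrow> f x = f\<^sub>0 x"
    and \<psi>: "continuous_on UNIV \<psi>" and supp: "\<And>x. x \<le> 0 \<Longrightarrow> \<psi> x = 0"
  shows "(LINT x:{0<..}|lebesgue. f x * \<psi> x) = (LINT x|lborel. f\<^sub>0 x * \<psi> x)"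
proof -
  have [measurable]: "\<psi> \<in> borel_measurable borel" using \<psi> by (rule borel_measurable_continuous_onI)
  have "(LINT x:{0<..}|lebesgue. f x * \<psi> x) = (LINT x:{0<..}|lborel. f\<^sub>0 x * \<psi> x)"
    by (rule LINT_lebesgue_eq_lborel) (use AE in \<open>auto simp: set_borel_measurable_def\<close>)
  also have "\<dots> = (LINT x|lborel. f\<^sub>0 x * \<psi> x)"
    unfolding set_lebesgue_integral_def
    by (intro Bochner_Integration.integral_cong) (use supp in \<open>auto split: split_indicator\<close>)
  finally show ?thesis .
qed

lemma has_weak_derivative_on_Ioi_iff:
  assumes [measurable]: "u\<^sub>0 \<in> borel_measurable borel" "g\<^sub>0 \<in> borel_measurable borel"
    and AE_u: "AE x in lborel. 0 < x \<longrightarrow> u x = u\<^sub>0 x" and AE_g: "AE x in lborel. 0 < x \<longrightarrow> g x = g\<^sub>0 x"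
  shows "has_weak_derivative_on {0<..} u g \<longleftrightarrow>
    locally_integrable_Ioi u\<^sub>0 \<and> locally_integrable_Ioi g\<^sub>0 \<and>
    (\<forall>\<phi> a b. 0 < a \<longrightarrow> a < b \<longrightarrow> smooth \<phi> \<longrightarrow> (\<forall>x. x \<notin> {a<..<b} \<longrightarrow> \<phi> x = 0) \<longrightarrow>
      (LINT s|lborel. u\<^sub>0 s * deriv \<phi> s) = - (LINT s|lborel. g\<^sub>0 s * \<phi> s))"
proof -
  have LINT: "(LINT s:{0<..}|lebesgue. u s * deriv \<phi> s) = (LINT s|lborel. u\<^sub>0 s * deriv \<phi> s)"
    "(LINT s:{0<..}|lebesgue. g s * \<phi> s) = (LINT s|lborel. g\<^sub>0 s * \<phi> s)"
    if "0 < a" "smooth \<phi>" "\<And>x. x \<notin> {a<..<b} \<Longrightarrow> \<phi> x = 0" for \<phi> a b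
  proof -
    have "deriv \<phi> x = 0" if "x \<le> 0" for x
      using that \<open>0 < a\<close> by (intro deriv_eq_0_outside[of a b]) (use \<open>\<And>x. x \<notin> {a<..<b} \<Longrightarrow> \<phi> x = 0\<close> in auto)
    then show "(LINT s:{0<..}|lebesgue. u s * deriv \<phi> s) = (LINT s|lborel. u\<^sub>0 s * deriv \<phi> s)"
      by (intro LINT_Ioi_mult_lebesgue_eq_lborel AE_u smooth_continuous_on smooth_deriv that) auto
    show "(LINT s:{0<..}|lebesgue. g s * \<phi> s) = (LINT s|lborel. g\<^sub>0 s * \<phi> s)"
      by (intro LINT_Ioi_mult_lebesgue_eq_lborel AE_g smooth_continuous_on that) (use that(1) in auto)
  qed
  have "(\<forall>\<phi>. test_function_on {0<..} \<phi> \<longrightarrow>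
        (LINT s:{0<..}|lebesgue. u s * deriv \<phi> s) = - (LINT s:{0<..}|lebesgue. g s * \<phi> s)) \<longleftrightarrow>
    (\<forall>\<phi> a b. 0 < a \<longrightarrow> a < b \<longrightarrow> smooth \<phi> \<longrightarrow> (\<forall>x. x \<notin> {a<..<b} \<longrightarrow> \<phi> x = 0) \<longrightarrow>
      (LINT s|lborel. u\<^sub>0 s * deriv \<phi> s) = - (LINT s|lborel. g\<^sub>0 s * \<phi> s))"
    (is "?weak \<longleftrightarrow> ?lborel")
  proof
    assume weak: ?weak
    show ?lborel
    proof (intro allI impI)
      fix \<phi> a b assume \<phi>: "0 < a" "a < b" "smooth \<phi>" "\<forall>x. x \<notin> {a<..<b} \<longrightarrow> \<phi> x = 0"
      then have supp: "\<phi> x = 0" if "x \<notin> {a<..<b}" for x using that by blast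
      show "(LINT s|lborel. u\<^sub>0 s * deriv \<phi> s) = - (LINT s|lborel. g\<^sub>0 s * \<phi> s)"
        using weak[rule_format, OF test_function_on_Ioi[OF \<phi>(1,3) supp]] LINT[OF \<phi>(1,3) supp] by simp
    qed
  next
    assume lborel: ?lborel
    show ?weak
    proof (intro allI impI)
      fix \<phi> assume "test_function_on {0<..} \<phi>"
      then obtain a b where \<phi>: "0 < a" "a < b" "smooth \<phi>" "\<And>x. x \<notin> {a<..<b} \<Longrightarrow> \<phi> x = 0"
        by (rule test_function_on_Ioi_support) blast
      then show "(LINT s:{0<..}|lebesgue. u s * deriv \<phi> s) = - (LINT s:{0<..}|lebesgue. g s * \<phi> s)"
        using lborel[rule_format, OF \<phi>] LINT[OF \<phi>(1,3,4)] by simp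
    qed
  qed
  then show ?thesis
    unfolding has_weak_derivative_on_def
    using locally_integrable_on_Ioi_iff[OF _ AE_u] locally_integrable_on_Ioi_iff[OF _ AE_g] by simp
qed

lemma has_weak_derivative_on_Ioi_primitive:
  assumes "has_weak_derivative_on {0<..} u g"
  obtains U g\<^sub>0 where "U \<in> borel_measurable borel" "g\<^sub>0 \<in> borel_measurable borel" "primitive_Ioi U g\<^sub>0"
    "AE x in lborel. 0 < x \<longrightarrow> u x = U x" "AE x in lborel. 0 < x \<longrightarrow> g x = g\<^sub>0 x"
proof -
  have loc: "locally_integrable_on {0<..} u" "locally_integrable_on {0<..} g"
    using assms by (auto simp: has_weak_derivative_on_def)
  obtain u\<^sub>0 where u\<^sub>0: "u\<^sub>0 \<in> borel_measurable borel" "AE x in lborel. 0 < x \<longrightarrow> u x = u\<^sub>0 x"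
    "locally_integrable_Ioi u\<^sub>0"
    using locally_integrable_on_Ioi_borel_representative[OF loc(1)] .
  obtain g\<^sub>0 where g\<^sub>0: "g\<^sub>0 \<in> borel_measurable borel" "AE x in lborel. 0 < x \<longrightarrow> g x = g\<^sub>0 x"
    "locally_integrable_Ioi g\<^sub>0"
    using locally_integrable_on_Ioi_borel_representative[OF loc(2)] .
  obtain W where W: "primitive_Ioi W g\<^sub>0" "AE s in lborel. 0 < s \<longrightarrow> u\<^sub>0 s = W s"
    using assms has_weak_derivative_on_Ioi_iff[OF u\<^sub>0(1) g\<^sub>0(1) u\<^sub>0(2) g\<^sub>0(2)]
    by (elim du_Bois_Reymond_Ioi[OF u\<^sub>0(3) g\<^sub>0(3), rotated]) blast
  \<comment> \<open>Cut off to the half-line, where \<open>W\<close> is continuous, so that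
    \<open>U\<close> is Borel on the whole line.\<close>
  define U where "U x = indicator {0<..} x *\<^sub>R W x" for x
  show thesis
  proof (rule that[OF _ g\<^sub>0(1) _ _ g\<^sub>0(2)])
    show "U \<in> borel_measurable borel"
      unfolding U_def[abs_def]
      by (intro borel_measurable_continuous_on_indicator primitive_Ioi_continuous_on[OF W(1)]) auto
    show "primitive_Ioi U g\<^sub>0" using W(1) by (simp add: primitive_Ioi_def U_def)
    show "AE x in lborel. 0 < x \<longrightarrow> u x = U x"
      using W(2) u\<^sub>0(2) by eventually_elim (auto simp: U_def)
  qed
qed

lemma has_weak_derivative_on_Ioi_if_primitive:
  assumes [measurable]: "U \<in> borel_measurable borel" "g \<in> borel_measurable borel"
    and U: "primitive_Ioi U g" and AE: "AE x in lborel. 0 < x \<longrightarrow> u x = U x"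
  shows "has_weak_derivative_on {0<..} u g"
  using continuous_on_Ioi_locally_integrable[OF primitive_Ioi_continuous_on[OF U]]
    primitive_IoiD(1)[OF U] primitive_Ioi_integration_by_parts[OF U]
  by (subst has_weak_derivative_on_Ioi_iff[OF assms(1,2) AE]) auto

lemma has_weak_derivative_on_Ioi_unique:
  assumes "has_weak_derivative_on {0<..} u g" "has_weak_derivative_on {0<..} u h"
  shows "AE x in lborel. 0 < x \<longrightarrow> g x = h x"
proof -
  obtain U g\<^sub>0 where U: "U \<in> borel_measurable borel" "g\<^sub>0 \<in> borel_measurable borel" "primitive_Ioi U g\<^sub>0"
    "AE x in lborel. 0 < x \<longrightarrow> u x = U x" "AE x in lborel. 0 < x \<longrightarrow> g x = g\<^sub>0 x"
    using has_weak_derivative_on_Ioi_primitive[OF assms(1)] .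
  obtain V h\<^sub>0 where V: "V \<in> borel_measurable borel" "h\<^sub>0 \<in> borel_measurable borel" "primitive_Ioi V h\<^sub>0"
    "AE x in lborel. 0 < x \<longrightarrow> u x = V x" "AE x in lborel. 0 < x \<longrightarrow> h x = h\<^sub>0 x"
    using has_weak_derivative_on_Ioi_primitive[OF assms(2)] .
  have "AE x in lborel. 0 < x \<longrightarrow> g\<^sub>0 x - h\<^sub>0 x = 0"
  proof (rule fundamental_lemma_Ioi)
    show "locally_integrable_Ioi (\<lambda>x. g\<^sub>0 x - h\<^sub>0 x)"
      using U(3) V(3) by (intro locally_integrable_Ioi_diff primitive_IoiD(1))
    fix \<phi> :: "real \<Rightarrow> real" and a b
    assume \<phi>: "0 < a" "a < b" "smooth \<phi>" "\<And>x. x \<notin> {a<..<b} \<Longrightarrow> \<phi> x = 0"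
    have "(LINT s|lborel. g\<^sub>0 s * \<phi> s) = (LINT s|lborel. h\<^sub>0 s * \<phi> s)"
      using assms(1)[unfolded has_weak_derivative_on_Ioi_iff[OF U(1,2,4,5)]]
        assms(2)[unfolded has_weak_derivative_on_Ioi_iff[OF U(1) V(2) U(4) V(5)]] \<phi>
      by force
    moreover have "integrable lborel (\<lambda>s. f s * \<phi> s)" if "primitive_Ioi F f" for F f
      using locally_integrable_IoiD[OF primitive_IoiD(1)[OF that] \<phi>(1), of b] \<phi>(4)
      by (intro integrable_mult_continuous_compact_support[OF _ smooth_continuous_on[OF \<phi>(3)]]) auto
    ultimately show "(LINT s|lborel. (g\<^sub>0 s - h\<^sub>0 s) * \<phi> s) = 0"
      using U(3) V(3) by (simp add: left_diff_distrib)
  qed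
  with U(5) V(5) show ?thesis by eventually_elim auto
qed

subsection \<open>Optimality of the quadratic functions\<close>

lemma weighted_LINT_lebesgue_eq_lborel:
  assumes [measurable]: "U \<in> borel_measurable borel" and AE: "AE x in lborel. 0 < x \<longrightarrow> u x = U x"
  shows "(LINT s:{0<..}|lebesgue. \<bar>u s - c\<bar>\<^sup>2 * gauss_weight \<alpha> s) =
    (LINT s:{0<..}|lborel. (U s - c)\<^sup>2 * gauss_weight \<alpha> s)"
  using AE by (intro LINT_lebesgue_eq_lborel) (auto simp: set_borel_measurable_def)

text \<open>Membership only asserts that some weak derivative \<open>h\<close> has finite energy;
  uniqueness transfers this to the given \<open>u'\<close> and to its Borel representative.\<close>

lemma weighted_W12_Ioi_primitive:
  assumes u: "u \<in> weighted_W12 {0<..} (gauss_weight \<alpha>)" and u': "has_weak_derivative_on {0<..} u u'"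
  obtains U g where "U \<in> borel_measurable borel" "g \<in> borel_measurable borel" "primitive_Ioi U g"
    "AE x in lborel. 0 < x \<longrightarrow> u x = U x" "AE x in lborel. 0 < x \<longrightarrow> u' x = g x"
    "set_integrable lborel {0<..} (\<lambda>x. (g x)\<^sup>2 * gauss_weight \<alpha> x)"
proof -
  obtain h where h: "has_weak_derivative_on {0<..} u h"
    "set_integrable lebesgue {0<..} (\<lambda>s. (\<bar>u s\<bar>\<^sup>2 + \<bar>h s\<bar>\<^sup>2) * gauss_weight \<alpha> s)"
    using u by (auto simp: weighted_W12_def)
  obtain U g where U: "U \<in> borel_measurable borel" "g \<in> borel_measurable borel" "primitive_Ioi U g"
    "AE x in lborel. 0 < x \<longrightarrow> u x = U x" "AE x in lborel. 0 < x \<longrightarrow> u' x = g x"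
    using has_weak_derivative_on_Ioi_primitive[OF u'] .
  note [measurable] = U(1,2)
  have "AE x in lborel. 0 < x \<longrightarrow> h x = g x"
    using has_weak_derivative_on_Ioi_unique[OF h(1) u'] U(5) by eventually_elim auto
  then have "AE x in lborel. x \<in> {0<..} \<longrightarrow>
      (\<bar>u x\<bar>\<^sup>2 + \<bar>h x\<bar>\<^sup>2) * gauss_weight \<alpha> x = ((U x)\<^sup>2 + (g x)\<^sup>2) * gauss_weight \<alpha> x"
    using U(4) by eventually_elim auto
  then have "set_integrable lborel {0<..} (\<lambda>x. ((U x)\<^sup>2 + (g x)\<^sup>2) * gauss_weight \<alpha> x)"
    using h(2) by (subst (asm) set_integrable_lebesgue_iff_lborel[rotated 2]) (auto simp: set_borel_measurable_def)
  then have "set_integrable lborel {0<..} (\<lambda>x. (g x)\<^sup>2 * gauss_weight \<alpha> x)"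
    by (rule set_integrable_bound)
      (auto simp: set_borel_measurable_def abs_mult gauss_weight_nonneg intro!: mult_right_mono)
  with U show thesis by (rule that)
qed

text \<open>An infimum of reals is a lower bound only for a set bounded below, so each comparison
  with a chosen constant relies on this.\<close>

lemma bdd_below_weighted_LINT:
  "bdd_below (range (\<lambda>c. LINT s:{0<..}|lborel. (U s - c)\<^sup>2 * gauss_weight \<alpha> s))"
  unfolding set_lebesgue_integral_def
  by (intro bdd_belowI2[of _ 0] integral_nonneg_AE AE_I2) (auto simp: gauss_weight_nonneg)

lemma
  assumes "0 < \<alpha>" and AE: "AE s in lborel. 0 < s \<longrightarrow> u s = a\<^sub>0 + a\<^sub>1 * s\<^sup>2"
  shows quadratic_has_weak_derivative: "has_weak_derivative_on {0<..} u (\<lambda>s. 2 * a\<^sub>1 * s)"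
    and quadratic_mem_weighted_W12: "u \<in> weighted_W12 {0<..} (gauss_weight \<alpha>)"
proof -
  have "primitive_Ioi (\<lambda>s. a\<^sub>0 + a\<^sub>1 * s\<^sup>2) (\<lambda>s. 2 * a\<^sub>1 * s)"
    unfolding primitive_Ioi_def
  proof (intro conjI allI impI)
    show "locally_integrable_Ioi (\<lambda>s. 2 * a\<^sub>1 * s)"
      by (intro continuous_on_Ioi_locally_integrable continuous_intros)
    fix x y :: real assume "x \<le> y"
    then have "(LINT t|lborel. (2 * a\<^sub>1 * t) * indicator {x..y} t) = (a\<^sub>0 + a\<^sub>1 * y\<^sup>2) - (a\<^sub>0 + a\<^sub>1 * x\<^sup>2)"
      by (intro integral_FTC_Icc_real) (auto intro!: derivative_eq_intros)
    then show "a\<^sub>0 + a\<^sub>1 * y\<^sup>2 - (a\<^sub>0 + a\<^sub>1 * x\<^sup>2) = (LINT t:{x..y}|lborel. 2 * a\<^sub>1 * t)"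
      by (simp only: set_lebesgue_integral_def real_scaleR_def mult.commute)
  qed
  then show deriv: "has_weak_derivative_on {0<..} u (\<lambda>s. 2 * a\<^sub>1 * s)"
    by (rule has_weak_derivative_on_Ioi_if_primitive[rotated 2]) (use AE in auto)
  have "set_integrable lborel {0<..} (\<lambda>s. a\<^sub>0\<^sup>2 * gauss_weight \<alpha> s +
      (2 * a\<^sub>0 * a\<^sub>1 + 4 * a\<^sub>1\<^sup>2) * (s\<^sup>2 * gauss_weight \<alpha> s) + a\<^sub>1\<^sup>2 * (s ^ 4 * gauss_weight \<alpha> s))"
    by (intro set_integral_add set_integrable_mult_right gauss_weight_integrable
        gauss_weight_square_integrable gauss_weight_power4_integrable assms(1))
  moreover have "a\<^sub>0\<^sup>2 * gauss_weight \<alpha> s + (2 * a\<^sub>0 * a\<^sub>1 + 4 * a\<^sub>1\<^sup>2) * (s\<^sup>2 * gauss_weight \<alpha> s) +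
      a\<^sub>1\<^sup>2 * (s ^ 4 * gauss_weight \<alpha> s) = ((a\<^sub>0 + a\<^sub>1 * s\<^sup>2)\<^sup>2 + (2 * a\<^sub>1 * s)\<^sup>2) * gauss_weight \<alpha> s" for s
    by algebra
  ultimately have "set_integrable lborel {0<..}
      (\<lambda>s. ((a\<^sub>0 + a\<^sub>1 * s\<^sup>2)\<^sup>2 + (2 * a\<^sub>1 * s)\<^sup>2) * gauss_weight \<alpha> s)"
    by simp
  then have "set_integrable lebesgue {0<..} (\<lambda>s. (\<bar>u s\<bar>\<^sup>2 + \<bar>2 * a\<^sub>1 * s\<bar>\<^sup>2) * gauss_weight \<alpha> s)"
    using AE by (subst set_integrable_lebesgue_iff_lborel) (auto simp: set_borel_measurable_def)
  with deriv show "u \<in> weighted_W12 {0<..} (gauss_weight \<alpha>)"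
    unfolding weighted_W12_def by blast
qed

lemma quadratic_weighted_energy:
  assumes "0 < \<alpha>" and AE: "AE s in lborel. 0 < s \<longrightarrow> u s = a\<^sub>0 + a\<^sub>1 * s\<^sup>2"
    and u': "has_weak_derivative_on {0<..} u u'"
  shows "(LINT s:{0<..}|lebesgue. \<bar>u' s\<bar>\<^sup>2 * gauss_weight \<alpha> s) =
    4 * a\<^sub>1\<^sup>2 * \<alpha> * (LINT s:{0<..}|lborel. gauss_weight \<alpha> s)"
proof -
  have "AE s in lborel. 0 < s \<longrightarrow> u' s = 2 * a\<^sub>1 * s"
    by (rule has_weak_derivative_on_Ioi_unique[OF u' quadratic_has_weak_derivative[OF assms(1) AE]])
  then have "(LINT s:{0<..}|lebesgue. \<bar>u' s\<bar>\<^sup>2 * gauss_weight \<alpha> s) =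
      (LINT s:{0<..}|lborel. 4 * a\<^sub>1\<^sup>2 * (s\<^sup>2 * gauss_weight \<alpha> s))"
    by (intro LINT_lebesgue_eq_lborel) (auto simp: set_borel_measurable_def power_mult_distrib)
  also have "\<dots> = 4 * a\<^sub>1\<^sup>2 * (\<alpha> * (LINT s:{0<..}|lborel. gauss_weight \<alpha> s))"
    unfolding set_integral_mult_right gauss_weight_second_moment[OF assms(1)] ..
  finally show ?thesis by simp
qed

lemma quadratic_weighted_variance:
  assumes "0 < \<alpha>" and AE: "AE s in lborel. 0 < s \<longrightarrow> u s = a\<^sub>0 + a\<^sub>1 * s\<^sup>2"
  shows "(INF c::real. LINT s:{0<..}|lebesgue. \<bar>u s - c\<bar>\<^sup>2 * gauss_weight \<alpha> s) =
    2 * a\<^sub>1\<^sup>2 * \<alpha> * (LINT s:{0<..}|lborel. gauss_weight \<alpha> s)"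
proof -
  define Z where "Z = (LINT s:{0<..}|lborel. gauss_weight \<alpha> s)"
  define v where "v s = a\<^sub>1 * (s\<^sup>2 - \<alpha>)" for s
  have [measurable]: "v \<in> borel_measurable borel" unfolding v_def[abs_def] by measurable
  note int = gauss_weight_integrable[OF assms(1)] gauss_weight_square_integrable[OF assms(1)]
    gauss_weight_power4_integrable[OF assms(1)]
  have v_sq: "(v s)\<^sup>2 * gauss_weight \<alpha> s = a\<^sub>1\<^sup>2 * (s ^ 4 * gauss_weight \<alpha> s) -
      (2 * a\<^sub>1\<^sup>2 * \<alpha>) * (s\<^sup>2 * gauss_weight \<alpha> s) + (a\<^sub>1\<^sup>2 * \<alpha>\<^sup>2) * gauss_weight \<alpha> s" for s
    unfolding v_def by algebra
  have v_int: "set_integrable lborel {0<..} (\<lambda>s. (v s)\<^sup>2 * gauss_weight \<alpha> s)"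
    unfolding v_sq by (intro set_integral_add set_integral_diff set_integrable_mult_right int)
  have v_LINT: "(LINT s:{0<..}|lborel. (v s)\<^sup>2 * gauss_weight \<alpha> s) = 2 * a\<^sub>1\<^sup>2 * \<alpha> * Z"
  proof -
    \<comment> \<open>Up to the mass \<open>Z\<close>, the variance of \<open>s^2\<close> is
      (\<alpha> + 2) \<alpha> - 2 \<alpha> \<alpha> + \<alpha> \<alpha> = 2 \<alpha>; the energy of
      \<open>s^2\<close> is 4 \<alpha>, whence the ratio 2.\<close>
    have "(LINT s:{0<..}|lborel. (v s)\<^sup>2 * gauss_weight \<alpha> s) =
        a\<^sub>1\<^sup>2 * ((\<alpha> + 2) * \<alpha> * Z) - (2 * a\<^sub>1\<^sup>2 * \<alpha>) * (\<alpha> * Z) + (a\<^sub>1\<^sup>2 * \<alpha>\<^sup>2) * Z"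
      unfolding v_sq Z_def gauss_weight_fourth_moment[OF assms(1), symmetric]
        gauss_weight_second_moment[OF assms(1), symmetric]
      using int by (simp only: set_integral_add set_integral_diff set_integrable_mult_right set_integral_mult_right)
    also have "\<dots> = 2 * a\<^sub>1\<^sup>2 * \<alpha> * Z" by algebra
    finally show ?thesis .
  qed
  have v_mean: "(LINT s:{0<..}|lborel. v s * gauss_weight \<alpha> s) = 0"
  proof -
    have "v s * gauss_weight \<alpha> s = (- a\<^sub>1) * ((\<alpha> - s\<^sup>2) * gauss_weight \<alpha> s)" for s
      unfolding v_def by algebra
    then show ?thesis
      using gauss_weight_centered_total[OF assms(1)] by (simp only: set_integral_mult_right)
  qed
  have J: "(LINT s:{0<..}|lebesgue. \<bar>u s - c\<bar>\<^sup>2 * gauss_weight \<alpha> s) =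
      2 * a\<^sub>1\<^sup>2 * \<alpha> * Z + (c - (a\<^sub>0 + a\<^sub>1 * \<alpha>))\<^sup>2 * Z" for c
  proof -
    have "(LINT s:{0<..}|lebesgue. \<bar>u s - c\<bar>\<^sup>2 * gauss_weight \<alpha> s) =
        (LINT s:{0<..}|lborel. (a\<^sub>0 + a\<^sub>1 * s\<^sup>2 - c)\<^sup>2 * gauss_weight \<alpha> s)"
      by (rule weighted_LINT_lebesgue_eq_lborel[OF _ AE]) measurable
    also have "\<dots> = (LINT s:{0<..}|lborel. (v s - (c - (a\<^sub>0 + a\<^sub>1 * \<alpha>)))\<^sup>2 * gauss_weight \<alpha> s)"
      by (simp add: v_def algebra_simps)
    finally show ?thesis
      using weighted_variance_expansion[OF assms(1) v_int] v_LINT v_mean by (simp add: Z_def)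
  qed
  have "0 < Z" unfolding Z_def by (rule gauss_weight_mass_pos[OF assms(1)])
  then have "(INF c. 2 * a\<^sub>1\<^sup>2 * \<alpha> * Z + (c - (a\<^sub>0 + a\<^sub>1 * \<alpha>))\<^sup>2 * Z) = 2 * a\<^sub>1\<^sup>2 * \<alpha> * Z"
    \<comment> \<open>The infimum is attained at the mean of the quadratic function.\<close>
    by (intro cInf_eq_minimum) (auto intro!: image_eqI[of _ _ "a\<^sub>0 + a\<^sub>1 * \<alpha>"])
  then show ?thesis by (simp only: J Z_def)
qed

theorem theorem1p3:
  fixes \<alpha> :: real
  assumes "\<alpha> > 0"
  shows "(\<forall>u \<in> weighted_W12 {0<..} (gauss_weight \<alpha>). \<forall>u'. has_weak_derivative_on {0<..} u u' \<longrightarrow>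
            (LINT s:{0<..}|lebesgue. \<bar>u' s\<bar>\<^sup>2 * gauss_weight \<alpha> s)
              \<ge> 2 * (INF c::real. LINT s:{0<..}|lebesgue. \<bar>u s - c\<bar>\<^sup>2 * gauss_weight \<alpha> s))
       \<and> (\<forall>C::real.
            (\<forall>u \<in> weighted_W12 {0<..} (gauss_weight \<alpha>). \<forall>u'. has_weak_derivative_on {0<..} u u' \<longrightarrow>
               (LINT s:{0<..}|lebesgue. \<bar>u' s\<bar>\<^sup>2 * gauss_weight \<alpha> s)
                 \<ge> C * (INF c::real. LINT s:{0<..}|lebesgue. \<bar>u s - c\<bar>\<^sup>2 * gauss_weight \<alpha> s))
            \<longrightarrow> C \<le> 2)
       \<and> (\<forall>u::real \<Rightarrow> real.
            (u \<in> weighted_W12 {0<..} (gauss_weight \<alpha>) \<and>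
             (\<forall>u'. has_weak_derivative_on {0<..} u u' \<longrightarrow>
               (LINT s:{0<..}|lebesgue. \<bar>u' s\<bar>\<^sup>2 * gauss_weight \<alpha> s)
                 = 2 * (INF c::real. LINT s:{0<..}|lebesgue. \<bar>u s - c\<bar>\<^sup>2 * gauss_weight \<alpha> s)))
            \<longleftrightarrow> (\<exists>a\<^sub>0 a\<^sub>1 :: real. AE s in lebesgue. s \<in> {0<..} \<longrightarrow> u s = a\<^sub>0 + a\<^sub>1 * s\<^sup>2))"
proof (intro conjI ballI allI impI)
  fix u u' assume u: "u \<in> weighted_W12 {0<..} (gauss_weight \<alpha>)" "has_weak_derivative_on {0<..} u u'"
  obtain U g where U: "U \<in> borel_measurable borel" "g \<in> borel_measurable borel" "primitive_Ioi U g"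
    "AE x in lborel. 0 < x \<longrightarrow> u x = U x" "AE x in lborel. 0 < x \<longrightarrow> u' x = g x"
    "set_integrable lborel {0<..} (\<lambda>x. (g x)\<^sup>2 * gauss_weight \<alpha> x)"
    using weighted_W12_Ioi_primitive[OF u] .
  have "2 * (INF c. LINT s:{0<..}|lborel. (U s - c)\<^sup>2 * gauss_weight \<alpha> s) \<le>
      2 * (LINT s:{0<..}|lborel. (U s - U (sqrt \<alpha>))\<^sup>2 * gauss_weight \<alpha> s)"
    using cINF_lower[OF bdd_below_weighted_LINT, of "U (sqrt \<alpha>)" U \<alpha>] by simp
  also have "\<dots> \<le> (LINT s:{0<..}|lborel. (g s)\<^sup>2 * gauss_weight \<alpha> s)"
    by (rule weighted_poincare_primitive(2)[OF assms U(2,3,6)])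
  finally show "2 * (INF c. LINT s:{0<..}|lebesgue. \<bar>u s - c\<bar>\<^sup>2 * gauss_weight \<alpha> s) \<le>
      (LINT s:{0<..}|lebesgue. \<bar>u' s\<bar>\<^sup>2 * gauss_weight \<alpha> s)"
    using weighted_LINT_lebesgue_eq_lborel[OF U(1,4)] weighted_LINT_lebesgue_eq_lborel[OF U(2,5), of 0]
    by simp
next
  fix C :: real
  assume C: "\<forall>u \<in> weighted_W12 {0<..} (gauss_weight \<alpha>). \<forall>u'. has_weak_derivative_on {0<..} u u' \<longrightarrow>
    (LINT s:{0<..}|lebesgue. \<bar>u' s\<bar>\<^sup>2 * gauss_weight \<alpha> s)
      \<ge> C * (INF c::real. LINT s:{0<..}|lebesgue. \<bar>u s - c\<bar>\<^sup>2 * gauss_weight \<alpha> s)"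
  define Z where "Z = (LINT s:{0<..}|lborel. gauss_weight \<alpha> s)"
  have "0 < \<alpha> * Z" unfolding Z_def using assms gauss_weight_mass_pos[OF assms] by simp
  \<comment> \<open>The pure square, with coefficients 0 and 1, tests optimality: its variance is
    positive and the ratio is exactly 2.\<close>
  have AE: "AE s in lborel. 0 < s \<longrightarrow> s\<^sup>2 = 0 + 1 * (s::real)\<^sup>2" by simp
  note deriv = quadratic_has_weak_derivative[OF assms AE]
  have "C * (2 * 1\<^sup>2 * \<alpha> * Z) \<le> 4 * 1\<^sup>2 * \<alpha> * Z"
    using C[rule_format, OF quadratic_mem_weighted_W12[OF assms AE] deriv]
    unfolding quadratic_weighted_energy[OF assms AE deriv] quadratic_weighted_variance[OF assms AE]
    by (simp only: Z_def)
  then have "C * (\<alpha> * Z) \<le> 2 * (\<alpha> * Z)" by (simp add: mult.commute)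
  with \<open>0 < \<alpha> * Z\<close> show "C \<le> 2" by (simp only: mult_le_cancel_right_pos)
next
  fix u :: "real \<Rightarrow> real"
  show "(u \<in> weighted_W12 {0<..} (gauss_weight \<alpha>) \<and>
      (\<forall>u'. has_weak_derivative_on {0<..} u u' \<longrightarrow>
        (LINT s:{0<..}|lebesgue. \<bar>u' s\<bar>\<^sup>2 * gauss_weight \<alpha> s)
          = 2 * (INF c::real. LINT s:{0<..}|lebesgue. \<bar>u s - c\<bar>\<^sup>2 * gauss_weight \<alpha> s)))
    \<longleftrightarrow> (\<exists>a\<^sub>0 a\<^sub>1 :: real. AE s in lebesgue. s \<in> {0<..} \<longrightarrow> u s = a\<^sub>0 + a\<^sub>1 * s\<^sup>2)"
  proof (intro iffI; (elim conjE exE)?)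
    assume u: "u \<in> weighted_W12 {0<..} (gauss_weight \<alpha>)"
      and eq: "\<forall>u'. has_weak_derivative_on {0<..} u u' \<longrightarrow>
        (LINT s:{0<..}|lebesgue. \<bar>u' s\<bar>\<^sup>2 * gauss_weight \<alpha> s)
          = 2 * (INF c::real. LINT s:{0<..}|lebesgue. \<bar>u s - c\<bar>\<^sup>2 * gauss_weight \<alpha> s)"
    \<comment> \<open>The hypothesis \<open>eq\<close> ranges over all weak derivatives, so it says
      something only once one is known to exist; membership provides it.\<close>
    obtain u' where u': "has_weak_derivative_on {0<..} u u'"
      using u by (auto simp: weighted_W12_def)
    obtain U g where U: "U \<in> borel_measurable borel" "g \<in> borel_measurable borel" "primitive_Ioi U g"
      "AE x in lborel. 0 < x \<longrightarrow> u x = U x" "AE x in lborel. 0 < x \<longrightarrow> u' x = g x"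
      "set_integrable lborel {0<..} (\<lambda>x. (g x)\<^sup>2 * gauss_weight \<alpha> x)"
      using weighted_W12_Ioi_primitive[OF u u'] .
    define J where "J c = (LINT s:{0<..}|lborel. (U s - c)\<^sup>2 * gauss_weight \<alpha> s)" for c
    define E where "E = (LINT s:{0<..}|lborel. (g s)\<^sup>2 * gauss_weight \<alpha> s)"
    have E: "E = 2 * (INF c. J c)"
      using eq[rule_format, OF u'] weighted_LINT_lebesgue_eq_lborel[OF U(1,4)]
        weighted_LINT_lebesgue_eq_lborel[OF U(2,5), of 0]
      by (simp add: E_def J_def)
    have lower: "(INF c. J c) \<le> J c" for c
      unfolding J_def by (rule cINF_lower[OF bdd_below_weighted_LINT]) simp
    have upper: "2 * J (U (sqrt \<alpha>)) \<le> E"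
      unfolding J_def E_def by (rule weighted_poincare_primitive(2)[OF assms U(2,3,6)])
    \<comment> \<open>The chain \<open>2 * J (U (sqrt \<alpha>)) \<le> E\<close>,
      \<open>E = 2 * (INF c. J c)\<close> and \<open>(INF c. J c) \<le> J c\<close> makes
      \<open>U (sqrt \<alpha>)\<close> a minimiser of \<open>J\<close>, hence the mean of
      \<open>U\<close>.\<close>
    have "(LINT x:{0<..}|lborel. (U x - U (sqrt \<alpha>)) * gauss_weight \<alpha> x) = 0"
    proof (rule weighted_mean_eq_0_if_minimal[OF assms weighted_poincare_primitive(1)[OF assms U(2,3,6)]])
      fix d
      show "(LINT x:{0<..}|lborel. (U x - U (sqrt \<alpha>))\<^sup>2 * gauss_weight \<alpha> x) \<le>
          (LINT x:{0<..}|lborel. (U x - U (sqrt \<alpha>) - d)\<^sup>2 * gauss_weight \<alpha> x)"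
        using lower[of "U (sqrt \<alpha>) + d"] upper E by (simp add: J_def diff_diff_eq)
    qed (use U(1) in simp)
    moreover have "2 * J (U (sqrt \<alpha>)) = E"
      using lower[of "U (sqrt \<alpha>)"] upper E by simp
    ultimately obtain c where c: "\<And>x. 0 < x \<Longrightarrow> U x = U (sqrt \<alpha>) + c * (x\<^sup>2 - \<alpha>)"
      using weighted_poincare_primitive_equality[OF assms U(2,3,6)] unfolding J_def E_def by blast
    have "AE s in lborel. s \<in> {0<..} \<longrightarrow> u s = (U (sqrt \<alpha>) - c * \<alpha>) + c * s\<^sup>2"
      using U(4) by eventually_elim (use c in \<open>auto simp: algebra_simps\<close>)
    then show "\<exists>a\<^sub>0 a\<^sub>1 :: real. AE s in lebesgue. s \<in> {0<..} \<longrightarrow> u s = a\<^sub>0 + a\<^sub>1 * s\<^sup>2"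
      by (intro exI AE_completion)
  next
    fix a\<^sub>0 a\<^sub>1 :: real
    assume "AE s in lebesgue. s \<in> {0<..} \<longrightarrow> u s = a\<^sub>0 + a\<^sub>1 * s\<^sup>2"
    then have AE: "AE s in lborel. 0 < s \<longrightarrow> u s = a\<^sub>0 + a\<^sub>1 * s\<^sup>2"
      by (simp add: AE_completion_iff)
    show "u \<in> weighted_W12 {0<..} (gauss_weight \<alpha>) \<and>
      (\<forall>u'. has_weak_derivative_on {0<..} u u' \<longrightarrow>
        (LINT s:{0<..}|lebesgue. \<bar>u' s\<bar>\<^sup>2 * gauss_weight \<alpha> s)
          = 2 * (INF c::real. LINT s:{0<..}|lebesgue. \<bar>u s - c\<bar>\<^sup>2 * gauss_weight \<alpha> s))"
      using quadratic_mem_weighted_W12[OF assms AE] quadratic_weighted_energy[OF assms AE]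
        quadratic_weighted_variance[OF assms AE] by simp
  qed
qed

end
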